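(* If $K$ and $C_1,\ldots,C_s$ are isotropic unconditional convex bodies in $\mathbb{R}^n$ then, with $\mathcal{C}=(C_1,\ldots,C_s)$, $$\|\mathbf{t}\|_{\mathcal{C},K}\ \le\ c\sqrt{\log n}\cdot\max\{\|\mathbf{t}\|_2,\sqrt{\log n}\,\|\mathbf{t}\|_\infty\}$$ for every $\mathbf{t}=(t_1,\ldots,t_s)\in\mathbb{R}^s$, where $c>0$ is an absolute constant.
   Context: A convex body in $\mathbb{R}^n$ is a compact convex set with non-empty interior. A convex body $C$ is unconditional (with respect to the standard orthonormal basis) if $(x_1,\ldots,x_n)\in C$ implies $(\epsilon_1x_1,\ldots,\epsilon_nx_n)\in C$ for all signs $\epsilon_j\in\{-1,1\}$. It is isotropic if it has volume $1$, its barycenter is at the origin, and there is a constant $L_C>0$ with $\int_C\langle x,\xi\rangle^2dx=L_C^2$ for all $\xi\in S^{n-1}$. $\|x\|_K=\inf\{r>0:x/r\in K\}$, $\|\mathbf{t}\|_2$ is the Euclidean norm of $\mathbf{t}$ and $\|\mathbf{t}\|_\infty=\max_j|t_j|$. For bodies $C_j$ of volume $1$, $$\|\mathbf{t}\|_{\mathcal{C},K}=\int_{C_1}\cdots\int_{C_s}\Big\|\sum_{j=1}^st_jx_j\Big\|_K\,dx_1\cdots dx_s .$$ "Absolute constant" means independent of $n,s$, the bodies and $\mathbf{t}$.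
   Formalization: The dimension is assumed to satisfy n ≥ 2: for n = 1 the right-hand side is 0 since log 1 = 0, while for K = C_1 = [-1/2,1/2] and t = 1 the left-hand side is 1/2, so the claim fails there. *)

theory Defs
  imports "HOL-Analysis.Analysis"
begin

text \<open>
  The constant of the theorem has to be uniform in the dimension, so \<open>n\<close> must be a term and not a
  type. \<open>\<real>\<close>-vectors of length \<open>n\<close> are the functions in \<open>{..<n} \<rightarrow>\<^sub>E UNIV\<close>: this is both the space of
  \<open>\<Pi>\<^sub>M i\<in>{..<n}. lborel\<close> and the topspace of the product topology \<open>powertop_real {..<n}\<close>.
  Coordinates run over \<open>0, \<dots>, n - 1\<close>, and vector operations are restricted to \<open>{..<n}\<close> to stay in
  this space.
\<close>

definition lborel_n :: "nat \<Rightarrow> (nat \<Rightarrow> real) measure" where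
  "lborel_n n = (\<Pi>\<^sub>M i\<in>{..<n}. lborel)"

definition convex_body :: "nat \<Rightarrow> (nat \<Rightarrow> real) set \<Rightarrow> bool" where
  "convex_body n C \<longleftrightarrow>
     compactin (powertop_real {..<n}) C \<and>
     (\<forall>x\<in>C. \<forall>y\<in>C. \<forall>u\<in>{0..1}. (\<lambda>i\<in>{..<n}. (1 - u) * x i + u * y i) \<in> C) \<and>
     powertop_real {..<n} interior_of C \<noteq> {}"

definition unconditional :: "nat \<Rightarrow> (nat \<Rightarrow> real) set \<Rightarrow> bool" where
  "unconditional n C \<longleftrightarrow>
     (\<forall>x\<in>C. \<forall>\<epsilon>. (\<forall>i<n. \<epsilon> i \<in> {-1, 1}) \<longrightarrow> (\<lambda>i\<in>{..<n}. \<epsilon> i * x i) \<in> C)"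

definition isotropic :: "nat \<Rightarrow> (nat \<Rightarrow> real) set \<Rightarrow> bool" where
  "isotropic n C \<longleftrightarrow>
     measure (lborel_n n) C = 1 \<and>
     (\<forall>i<n. (LINT x:C|lborel_n n. x i) = 0) \<and>
     (\<exists>L>0. \<forall>\<xi>. L2_set \<xi> {..<n} = 1 \<longrightarrow>
        (LINT x:C|lborel_n n. (\<Sum>i<n. x i * \<xi> i)\<^sup>2) = L\<^sup>2)"

definition body_norm :: "nat \<Rightarrow> (nat \<Rightarrow> real) set \<Rightarrow> (nat \<Rightarrow> real) \<Rightarrow> real" where
  "body_norm n K x = Inf {r. r > 0 \<and> (\<lambda>i\<in>{..<n}. x i / r) \<in> K}"

text \<open>
  The \<open>s\<close>-fold integral over \<open>C\<^sub>1 \<times> \<dots> \<times> C\<^sub>s\<close> is taken with respect to the product measure. For the bodies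
  considered here (\<open>C\<^sub>j\<close> compact, \<open>0\<close> interior to \<open>K\<close>) the integrand is continuous and bounded on the
  domain of integration, so the integral exists.
\<close>

definition multi_norm ::
    "nat \<Rightarrow> nat \<Rightarrow> (nat \<Rightarrow> (nat \<Rightarrow> real) set) \<Rightarrow> (nat \<Rightarrow> real) set \<Rightarrow> (nat \<Rightarrow> real) \<Rightarrow> real" where
  "multi_norm n s C K t =
     (LINT x:(\<Pi>\<^sub>E j\<in>{..<s}. C j)|(\<Pi>\<^sub>M j\<in>{..<s}. lborel_n n).
        body_norm n K (\<lambda>i\<in>{..<n}. \<Sum>j<s. t j * x j i))"

definition max_norm :: "nat \<Rightarrow> (nat \<Rightarrow> real) \<Rightarrow> real" where
  "max_norm s t = Max ((\<lambda>j. \<bar>t j\<bar>) ` {..<s})"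

end

theory Submission
  imports Defs "HOL-Probability.Distributions"
begin

text \<open>
  For an unconditional body \<open>C\<close> of volume 1 let \<open>M\<^sub>i\<close> be the mean of \<open>\<bar>x\<^sub>i\<bar>\<close> over \<open>C\<close>. Everything rests on two
  facts about the vector \<open>M\<close>.

  First, \<open>\<bar>x\<^sub>i\<bar>\<close> is exponentially integrable at scale \<open>M\<^sub>i\<close>. The Prekopa-Leindler inequality, applied to
  the indicator of \<open>C\<close> and to its translates along the \<open>i\<close>-th axis, says that the tail \<open>u(a)\<close> of \<open>\<bar>x\<^sub>i\<bar>\<close>
  satisfies \<open>u(2a) \<le> u(a)\<^sup>2\<close> (\<open>prob_tail_double\<close>). Starting from \<open>u(4 M\<^sub>i) \<le> 1/4\<close>, which is Markov's
  inequality, the tail squares each time its argument doubles, so \<open>exp (c \<bar>x\<^sub>i\<bar> / M\<^sub>i)\<close> has bounded mean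
  (\<open>exp_moment\<close>) and the second moment of \<open>x\<^sub>i\<close> is at most a constant times \<open>M\<^sub>i\<^sup>2\<close>. Only the case of
  functions that are even and decreasing in every coordinate is needed, where superlevel sets on the
  line are symmetric intervals and the inequality \<open>\<bar>A\<bar> + \<bar>B\<bar> \<le> \<bar>A + B\<bar>\<close> is immediate.

  Second, \<open>M\<close> itself lies in \<open>C\<close>, being the barycenter of the image of \<open>C\<close> under coordinatewise
  absolute values (\<open>mean_abs_in_body\<close>). Since \<open>C\<close> is unconditional it contains the box with corner \<open>M\<close>,
  whose volume is at most 1.

  If \<open>C\<close> is isotropic, all second moments equal one number \<open>L\<^sup>2\<close>, and by the first fact all \<open>M\<^sub>i\<close> are
  comparable to \<open>L\<close>. The box bounds \<open>L\<close> from above. Comparing \<open>C\<close> with a Gaussian density through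
  Jensen's inequality bounds \<open>L\<close> from below. Hence every \<open>M\<^sub>i\<close> lies between two absolute constants
  (\<open>mean_abs_bounds\<close>). For \<open>K\<close> this says that \<open>K\<close> contains a cube of constant size, so that \<open>\<parallel>x\<parallel>\<^sub>K\<close> is at
  most a constant times \<open>max\<^sub>i \<bar>x\<^sub>i\<bar>\<close> (\<open>body_norm_le\<close>). For the \<open>C\<^sub>j\<close> it says that the coordinates, which
  have mean zero, have moment generating function \<open>exp (O(l\<^sup>2))\<close> for small \<open>l\<close> (\<open>mgf_coordinate\<close>).

  What remains is Bernstein's inequality for the maximum of the \<open>n\<close> sums \<open>\<Sum>\<^sub>j t\<^sub>j x\<^sub>j\<^sub>i\<close>
  (\<open>multi_norm_bernstein\<close>): for \<open>l \<parallel>t\<parallel>\<^sub>\<infinity>\<close> small its mean is \<open>O((log n + l\<^sup>2 \<parallel>t\<parallel>\<^sub>2\<^sup>2) / l)\<close>. The choice of \<open>l\<close>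
  proportional to \<open>sqrt (log n) / max {\<parallel>t\<parallel>\<^sub>2, sqrt (log n) \<parallel>t\<parallel>\<^sub>\<infinity>}\<close> gives the theorem.
\<close>

section \<open>The Prekopa-Leindler inequality for even decreasing functions\<close>

text \<open>
  Fubini, after writing \<open>f x\<close> as the length of the interval of those \<open>t \<ge> 0\<close> with \<open>t < f x\<close>.
\<close>
lemma nn_integral_layer_cake:
  fixes f :: "real \<Rightarrow> ennreal"
  assumes [measurable]: "f \<in> borel_measurable borel"
  shows "(\<integral>\<^sup>+x. f x \<partial>lborel) =
    (\<integral>\<^sup>+t. indicator {0..} t * emeasure lborel {x. ennreal t < f x} \<partial>lborel)"
proof -
  have *: "v = (\<integral>\<^sup>+t. indicator {0..} t * indicator {t. ennreal t < v} t \<partial>lborel)" for v :: ennreal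
  proof (cases v)
    case (real r)
    have "(\<integral>\<^sup>+t. indicator {0..} t * indicator {t. ennreal t < v} t \<partial>lborel) = (\<integral>\<^sup>+t. indicator {0..<r} t \<partial>lborel)"
      using real by (intro nn_integral_cong) (auto simp: indicator_def ennreal_less_iff)
    then show ?thesis using real by simp
  next
    case top
    have "(\<integral>\<^sup>+t. indicator {0..} t * indicator {t. ennreal t < v} t \<partial>lborel) = (\<integral>\<^sup>+(t::real). indicator {0..} t \<partial>lborel)"
      using top by (intro nn_integral_cong) (auto simp: indicator_def)
    also have "\<dots> = \<infinity>"
    proof -
      have "ennreal (real n) \<le> emeasure lborel {0::real..}" for n
        using emeasure_mono[of "{0..real n}" "{0::real..}" lborel] by auto
      then have "emeasure lborel {0::real..} = \<infinity>"
        by (metis ennreal_Ex_less_of_nat ennreal_of_nat_eq_real_of_nat infinity_ennreal_def less_top not_less)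
      then show ?thesis by simp
    qed
    finally show ?thesis using top by simp
  qed
  have "(\<integral>\<^sup>+x. f x \<partial>lborel) = (\<integral>\<^sup>+x. (\<integral>\<^sup>+t. indicator {0..} t * indicator {t. ennreal t < f x} t \<partial>lborel) \<partial>lborel)"
    by (subst *) simp
  also have "\<dots> = (\<integral>\<^sup>+t. (\<integral>\<^sup>+x. indicator {0..} t * indicator {t. ennreal t < f x} t \<partial>lborel) \<partial>lborel)"
    by (rule lborel_pair.Fubini') measurable
  also have "\<dots> = (\<integral>\<^sup>+t. indicator {0..} t * (\<integral>\<^sup>+x. indicator {x. ennreal t < f x} x \<partial>lborel) \<partial>lborel)"
    by (intro nn_integral_cong, subst nn_integral_cmult[symmetric]) 
       (auto intro!: nn_integral_cong simp: indicator_def)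
  finally show ?thesis by simp
qed

lemma midpoint_of_shorter:
  fixes x y z :: real
  assumes "0 \<le> x" "0 \<le> y" "\<bar>z\<bar> \<le> (x + y) / 2"
  obtains x' y' where "\<bar>x'\<bar> \<le> x" "\<bar>y'\<bar> \<le> y" "z = (x' + y') / 2"
proof (cases "x + y = 0")
  case True
  then show ?thesis using assms that[of 0 0] by simp
next
  case False
  define q where "q = 2 * z / (x + y)"
  have q: "\<bar>q\<bar> \<le> 1" using assms False by (auto simp: q_def abs_divide field_simps)
  have "z = (x * q + y * q) / 2"
  proof -
    have "x * q + y * q = (x + y) * q" by (simp add: algebra_simps)
    also have "\<dots> = 2 * z" using False by (simp add: q_def)
    finally show ?thesis by simp
  qed
  moreover have "\<bar>x * q\<bar> \<le> x" "\<bar>y * q\<bar> \<le> y"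
    using assms q by (auto simp: abs_mult intro: mult_left_le)
  ultimately show ?thesis using that by blast
qed

text \<open>
  The Brunn-Minkowski inequality on the line, for symmetric intervals \<open>S\<close> and \<open>T\<close> given through closure
  properties: their midpoints fill the open interval whose half-length is the mean of those of \<open>S\<close> and \<open>T\<close>.
\<close>
lemma level_sets_midpoint:
  fixes S T U :: "real set"
  assumes S: "0 \<in> S" "\<And>x y. y \<in> S \<Longrightarrow> \<bar>x\<bar> \<le> \<bar>y\<bar> \<Longrightarrow> x \<in> S" "\<And>x. x \<in> S \<Longrightarrow> \<bar>x\<bar> \<le> r"
    and T: "0 \<in> T" "\<And>x y. y \<in> T \<Longrightarrow> \<bar>x\<bar> \<le> \<bar>y\<bar> \<Longrightarrow> x \<in> T" "\<And>x. x \<in> T \<Longrightarrow> \<bar>x\<bar> \<le> r"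
    and U: "\<And>x y. x \<in> S \<Longrightarrow> y \<in> T \<Longrightarrow> (x + y) / 2 \<in> U"
    and [measurable]: "U \<in> sets borel"
  shows "emeasure lborel S + emeasure lborel T \<le> 2 * emeasure lborel U"
proof -
  define a where "a = Sup S"
  define b where "b = Sup T"
  have bdd: "bdd_above S" "bdd_above T"
    using S(3) T(3) by (meson abs_le_D1 bdd_aboveI)+
  have a0: "0 \<le> a" "0 \<le> b" using S(1) T(1) bdd by (auto simp: a_def b_def cSup_upper)
  have le_a: "\<bar>x\<bar> \<le> a" if "x \<in> S" for x
    unfolding a_def using S(2)[OF that, of "\<bar>x\<bar>"] bdd by (auto intro: cSup_upper)
  have le_b: "\<bar>x\<bar> \<le> b" if "x \<in> T" for x
    unfolding b_def using T(2)[OF that, of "\<bar>x\<bar>"] bdd by (auto intro: cSup_upper)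
  have 1: "emeasure lborel S \<le> ennreal (2 * a)"
    using emeasure_mono[of S "{-a..a}" lborel] le_a a0 by (fastforce simp: abs_le_iff)
  have 2: "emeasure lborel T \<le> ennreal (2 * b)"
    using emeasure_mono[of T "{-b..b}" lborel] le_b a0 by (fastforce simp: abs_le_iff)
  define m where "m = (a + b) / 2"
  have m: "a + b = 2 * m" "0 \<le> m" using a0 by (auto simp: m_def)
  have in_U: "z \<in> U" if z: "\<bar>z\<bar> < m" for z
  proof -
    define e where "e = m - \<bar>z\<bar>"
    have e: "e > 0" using z by (simp add: e_def)
    obtain x where x: "x \<in> S" "a - e < x"
      using less_cSup_iff[of S "a - e"] S(1) bdd e by (auto simp: a_def)
    obtain y where y: "y \<in> T" "b - e < y"
      using less_cSup_iff[of T "b - e"] T(1) bdd e by (auto simp: b_def)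
    have "\<bar>z\<bar> \<le> (\<bar>x\<bar> + \<bar>y\<bar>) / 2" using x(2) y(2) abs_ge_self[of x] abs_ge_self[of y] m unfolding e_def by argo
    then obtain x' y' where "\<bar>x'\<bar> \<le> \<bar>x\<bar>" "\<bar>y'\<bar> \<le> \<bar>y\<bar>" and z_eq: "z = (x' + y') / 2"
      using midpoint_of_shorter[of "\<bar>x\<bar>" "\<bar>y\<bar>" z] by auto
    then show "z \<in> U" unfolding z_eq by (intro U S(2)[OF x(1)] T(2)[OF y(1)])
  qed
  have "{-m<..<m} \<subseteq> U"
  proof
    fix z assume "z \<in> {-m<..<m}"
    then have "-m < z" "z < m" by (simp_all only: greaterThanLessThan_iff)
    then show "z \<in> U" by (intro in_U) linarith
  qed
  then have "emeasure lborel {-m<..<m} \<le> emeasure lborel U"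
    by (intro emeasure_mono) simp_all
  then have 3: "ennreal (a + b) \<le> emeasure lborel U" using m(2) by (simp add: m(1))
  have "emeasure lborel S + emeasure lborel T \<le> ennreal (2 * a) + ennreal (2 * b)"
    using 1 2 by (rule add_mono)
  also have "\<dots> = 2 * ennreal (a + b)"
    using a0 by (simp flip: ennreal_plus ennreal_mult'' ennreal_numeral add: algebra_simps)
  also have "\<dots> \<le> 2 * emeasure lborel U" using 3 by (intro mult_left_mono) auto
  finally show ?thesis .
qed

text \<open>
  When both functions have maximum 1, each superlevel set of \<open>h\<close> at a level below 1 contains all midpoints
  of the corresponding superlevel sets of \<open>f\<close> and \<open>g\<close>, and the layer cake formula adds up the levels. The
  additive form obtained here is stronger than the multiplicative one.
\<close>
lemma prekopa_leindler_1_normalised: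
  fixes f g h :: "real \<Rightarrow> ennreal"
  assumes [measurable]: "f \<in> borel_measurable borel" "g \<in> borel_measurable borel" "h \<in> borel_measurable borel"
    and f: "\<And>x y. \<bar>x\<bar> \<le> \<bar>y\<bar> \<Longrightarrow> f y \<le> f x" "\<And>x. \<bar>x\<bar> > r \<Longrightarrow> f x = 0" "f 0 = 1"
    and g: "\<And>x y. \<bar>x\<bar> \<le> \<bar>y\<bar> \<Longrightarrow> g y \<le> g x" "\<And>x. \<bar>x\<bar> > r \<Longrightarrow> g x = 0" "g 0 = 1"
    and fgh: "\<And>x y. f x * g y \<le> (h ((x + y) / 2))\<^sup>2"
  shows "(\<integral>\<^sup>+x. f x \<partial>lborel) + (\<integral>\<^sup>+x. g x \<partial>lborel) \<le> 2 * (\<integral>\<^sup>+x. h x \<partial>lborel)"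
proof -
  have *: "indicator {0..} t * emeasure lborel {x. ennreal t < f x} +
      indicator {0..} t * emeasure lborel {x. ennreal t < g x}
      \<le> 2 * (indicator {0..} t * emeasure lborel {x. ennreal t < h x})" for t :: real
  proof -
    consider "t < 0" | "0 \<le> t" "t < 1" | "t \<ge> 1" by linarith
    then show ?thesis
    proof cases
      case 2
      have "emeasure lborel {x. ennreal t < f x} + emeasure lborel {x. ennreal t < g x}
        \<le> 2 * emeasure lborel {x. ennreal t < h x}"
      proof (rule level_sets_midpoint[where r = r])
        fix x y assume xy: "x \<in> {x. ennreal t < f x}" "y \<in> {x. ennreal t < g x}"
        have "\<not> h ((x + y) / 2) \<le> ennreal t"
        proof
          assume "h ((x + y) / 2) \<le> ennreal t"
          then have "(h ((x + y) / 2))\<^sup>2 \<le> (ennreal t)\<^sup>2" by (rule power_mono) simp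
            also have "\<dots> < f x * g y"
          proof (cases "t = 0")
            case True
            then show ?thesis using xy by (auto simp: zero_less_iff_neq_zero)
          next
            case False
            have "ennreal t * ennreal t < f x * ennreal t"
              using xy 2 False by (intro ennreal_mult_strict_right_mono) auto
            also have "\<dots> \<le> f x * g y"
              using xy by (intro mult_left_mono) auto
            finally show ?thesis by (simp add: power2_eq_square)
          qed
          finally show False using fgh[of x y] by simp
        qed
        then show "(x + y) / 2 \<in> {x. ennreal t < h x}" by simp
      next
        fix x assume "x \<in> {x. ennreal t < f x}" then show "\<bar>x\<bar> \<le> r"
          using f(2)[of x] by fastforce
      next
        fix x assume "x \<in> {x. ennreal t < g x}" then show "\<bar>x\<bar> \<le> r"
          using g(2)[of x] by fastforce
      qed (use 2 f g in \<open>auto intro: less_le_trans\<close>)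
      then show ?thesis using 2 by simp
    next
      case 3
      have "f x \<le> 1" "g x \<le> 1" for x using f(1)[of 0 x] g(1)[of 0 x] f(3) g(3) by auto
      moreover have t: "1 \<le> ennreal t" using 3 by simp
      ultimately have "f x \<le> ennreal t" "g x \<le> ennreal t" for x
        by (blast intro: order_trans)+
      then have "{x. ennreal t < f x} = {}" "{x. ennreal t < g x} = {}"
        by (auto simp: not_less)
      then show ?thesis by simp
    qed auto
  qed
  show ?thesis
    unfolding nn_integral_layer_cake[OF assms(1)] nn_integral_layer_cake[OF assms(2)] nn_integral_layer_cake[OF assms(3)]
    by (subst nn_integral_add[symmetric], measurable, subst nn_integral_cmult[symmetric], measurable)
       (intro nn_integral_mono *)
qed

text \<open>
  Scaling \<open>f\<close> and \<open>g\<close> to maximum 1 and \<open>h\<close> by the geometric mean of the two factors preserves the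
  hypothesis. The arithmetic-geometric mean inequality then turns the sum into a product.
\<close>
lemma prekopa_leindler_1:
  fixes f g h :: "real \<Rightarrow> ennreal"
  assumes m[measurable]: "f \<in> borel_measurable borel" "g \<in> borel_measurable borel" "h \<in> borel_measurable borel"
    and f: "\<And>x y. \<bar>x\<bar> \<le> \<bar>y\<bar> \<Longrightarrow> f y \<le> f x" "\<And>x. \<bar>x\<bar> > r \<Longrightarrow> f x = 0" "f 0 < \<infinity>"
    and g: "\<And>x y. \<bar>x\<bar> \<le> \<bar>y\<bar> \<Longrightarrow> g y \<le> g x" "\<And>x. \<bar>x\<bar> > r \<Longrightarrow> g x = 0" "g 0 < \<infinity>"
    and fgh: "\<And>x y. f x * g y \<le> (h ((x + y) / 2))\<^sup>2"
  shows "(\<integral>\<^sup>+x. f x \<partial>lborel) * (\<integral>\<^sup>+x. g x \<partial>lborel) \<le> (\<integral>\<^sup>+x. h x \<partial>lborel)\<^sup>2"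
proof -
  obtain a b where ab: "f 0 = ennreal a" "g 0 = ennreal b" "0 \<le> a" "0 \<le> b"
    using f(3) g(3) by (metis ennreal_cases less_irrefl infinity_ennreal_def)
  show ?thesis
  proof (cases "a = 0 \<or> b = 0")
    case True
    then have "(\<forall>x. f x = 0) \<or> (\<forall>x. g x = 0)"
      using ab f(1)[of 0] g(1)[of 0] by auto
    then show ?thesis by auto
  next
    case False
    then have pos: "a > 0" "b > 0" using ab by auto
    define s where "s = sqrt (a * b)"
    have s: "s > 0" "s\<^sup>2 = a * b" using pos by (auto simp: s_def)
    have "(\<integral>\<^sup>+x. ennreal (1/a) * f x \<partial>lborel) + (\<integral>\<^sup>+x. ennreal (1/b) * g x \<partial>lborel) \<le> 2 * (\<integral>\<^sup>+x. ennreal (1/s) * h x \<partial>lborel)"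
    proof (rule prekopa_leindler_1_normalised[where r = r])
      fix x y
      have "ennreal (1/a) * f x * (ennreal (1/b) * g y) = ennreal ((1/s)\<^sup>2) * (f x * g y)"
      proof -
        have "ennreal ((1/s)\<^sup>2) = ennreal (1/a) * ennreal (1/b)"
          using pos s by (simp add: power_divide flip: ennreal_mult')
        then show ?thesis by (simp add: mult_ac)
      qed
      also have "\<dots> \<le> ennreal ((1/s)\<^sup>2) * (h ((x + y) / 2))\<^sup>2"
        by (intro mult_left_mono fgh) simp
      also have "\<dots> = (ennreal (1/s) * h ((x + y) / 2))\<^sup>2"
        using s by (simp add: power_mult_distrib ennreal_power)
      finally show "ennreal (1/a) * f x * (ennreal (1/b) * g y) \<le> (ennreal (1/s) * h ((x + y) / 2))\<^sup>2" .
    qed (use f g ab pos in \<open>auto intro: mult_left_mono simp flip: ennreal_mult'\<close>)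
    then have *: "ennreal (1/a) * (\<integral>\<^sup>+x. f x \<partial>lborel) + ennreal (1/b) * (\<integral>\<^sup>+x. g x \<partial>lborel) \<le> 2 * (ennreal (1/s) * (\<integral>\<^sup>+x. h x \<partial>lborel))"
      by (simp add: nn_integral_cmult)
    show ?thesis
    proof (cases "(\<integral>\<^sup>+x. h x \<partial>lborel)")
      case top
      then show ?thesis by simp
    next
      case (real H)
      have "ennreal (1/a) * (\<integral>\<^sup>+x. f x \<partial>lborel) < \<infinity>" "ennreal (1/b) * (\<integral>\<^sup>+x. g x \<partial>lborel) < \<infinity>"
        using le_less_trans[OF *, of \<infinity>] real by (auto simp: ennreal_mult_less_top)
      then have "(\<integral>\<^sup>+x. f x \<partial>lborel) < \<infinity>" "(\<integral>\<^sup>+x. g x \<partial>lborel) < \<infinity>"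
        using pos by (auto simp: ennreal_mult_less_top ennreal_eq_0_iff)
      then obtain F G where FG: "(\<integral>\<^sup>+x. f x \<partial>lborel) = ennreal F" "(\<integral>\<^sup>+x. g x \<partial>lborel) = ennreal G" "0 \<le> F" "0 \<le> G"
        by (metis ennreal_cases less_irrefl infinity_ennreal_def)
      have "F / a + G / b \<le> 2 * (H / s)"
        using * FG real pos s by (simp flip: ennreal_mult' ennreal_plus ennreal_numeral)
      then have "(F / a + G / b)\<^sup>2 \<le> (2 * (H / s))\<^sup>2"
        using FG pos by (intro power_mono) auto
      moreover have "4 * ((F / a) * (G / b)) \<le> (F / a + G / b)\<^sup>2"
        using zero_le_power2[of "F / a - G / b"] unfolding power2_sum power2_diff by linarith
      ultimately have "4 * ((F / a) * (G / b)) \<le> (2 * (H / s))\<^sup>2" by linarith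
      then have "F * G / (a * b) \<le> H\<^sup>2 / (a * b)" using s by (simp add: power_divide power_mult_distrib)
      then have "F * G \<le> H\<^sup>2" using pos by (simp add: divide_le_cancel)
      then show ?thesis using FG real by (simp add: ennreal_power flip: ennreal_mult')
    qed
  qed
qed

interpretation lborel_product: product_sigma_finite "\<lambda>_. lborel :: real measure"
  by standard

text \<open>
  Induction on the dimension: for fixed values of one coordinate the induction hypothesis compares the
  integrals over the remaining ones, and these marginals satisfy the hypotheses of the one-dimensional
  inequality. Domination by a multiple of the indicator of a box is the form of "bounded with bounded
  support" that passes to marginals; it makes their maxima finite.
\<close>
proposition prekopa_leindler_unconditional:
  fixes f g h :: "('i \<Rightarrow> real) \<Rightarrow> ennreal"
  assumes "finite I"
    and "f \<in> borel_measurable (\<Pi>\<^sub>M i\<in>I. lborel)" "g \<in> borel_measurable (\<Pi>\<^sub>M i\<in>I. lborel)"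
      "h \<in> borel_measurable (\<Pi>\<^sub>M i\<in>I. lborel)"
    and "\<And>x y. (\<And>i. i \<in> I \<Longrightarrow> \<bar>x i\<bar> \<le> \<bar>y i\<bar>) \<Longrightarrow> f y \<le> f x"
    and "\<And>x y. (\<And>i. i \<in> I \<Longrightarrow> \<bar>x i\<bar> \<le> \<bar>y i\<bar>) \<Longrightarrow> g y \<le> g x"
    and "M < \<infinity>" "\<And>x. f x \<le> M * (\<Prod>i\<in>I. indicator {-r..r} (x i))"
    and "\<And>x. g x \<le> M * (\<Prod>i\<in>I. indicator {-r..r} (x i))"
    and "\<And>x y. f x * g y \<le> (h (\<lambda>i. (x i + y i) / 2))\<^sup>2"
  shows "(\<integral>\<^sup>+x. f x \<partial>(\<Pi>\<^sub>M i\<in>I. lborel)) * (\<integral>\<^sup>+x. g x \<partial>(\<Pi>\<^sub>M i\<in>I. lborel))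
    \<le> (\<integral>\<^sup>+x. h x \<partial>(\<Pi>\<^sub>M i\<in>I. lborel))\<^sup>2"
  using assms
proof (induction I arbitrary: f g h rule: finite_induct)
  case empty
  have "(\<lambda>i. (undefined + undefined :: real) / 2) = (\<lambda>i::'i. undefined)" by simp
  then show ?case
    using empty.prems(9)[of "\<lambda>_. undefined" "\<lambda>_. undefined"]
    by (simp only: lborel_product.nn_integral_empty[OF zero_le])
next
  case (insert i I)
  let ?P = "\<Pi>\<^sub>M i\<in>I. (lborel :: real measure)"
  note [measurable] = insert.prems(1-3)
  interpret P: sigma_finite_measure ?P using insert(1) by (rule lborel_product.sigma_finite)
  define F where "F a = (\<integral>\<^sup>+x. f (x(i := a)) \<partial>?P)" for a
  define G where "G a = (\<integral>\<^sup>+x. g (x(i := a)) \<partial>?P)" for a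
  define H where "H a = (\<integral>\<^sup>+x. h (x(i := a)) \<partial>?P)" for a
  have [measurable]: "F \<in> borel_measurable borel" "G \<in> borel_measurable borel" "H \<in> borel_measurable borel"
    unfolding F_def G_def H_def by measurable
  have bound: "(\<integral>\<^sup>+x. k (x(i := a)) \<partial>?P) \<le> M * ennreal (2 * \<bar>r\<bar>) ^ card I * indicator {-r..r} a"
    if "\<And>x. k x \<le> M * (\<Prod>i\<in>insert i I. indicator {-r..r} (x i))" for k a
  proof -
    have "(\<integral>\<^sup>+x. k (x(i := a)) \<partial>?P) \<le> (\<integral>\<^sup>+x. (M * indicator {-r..r} a) * (\<Prod>i\<in>I. indicator {-r..r} (x i)) \<partial>?P)"
    proof (rule nn_integral_mono)
      fix x
      have "(\<Prod>j\<in>I. indicator {-r..r} ((x(i := a)) j)) = (\<Prod>j\<in>I. indicator {-r..r} (x j) :: ennreal)"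
        using insert(2) by (intro prod.cong) auto
      then show "k (x(i := a)) \<le> M * indicator {-r..r} a * (\<Prod>i\<in>I. indicator {-r..r} (x i))"
        using that[of "x(i := a)"] insert(1,2) by (simp add: mult_ac)
    qed
    also have "\<dots> = (M * indicator {-r..r} a) * (\<integral>\<^sup>+x. (\<Prod>i\<in>I. indicator {-r..r} (x i)) \<partial>?P)"
      using insert(1) by (intro nn_integral_cmult) measurable
    also have "(\<integral>\<^sup>+x. (\<Prod>i\<in>I. indicator {-r..r} (x i)) \<partial>?P) = (\<Prod>i\<in>I. \<integral>\<^sup>+y. indicator {-r..r} y \<partial>lborel)"
      using insert(1) by (intro lborel_product.product_nn_integral_prod) auto
    also have "\<dots> = emeasure lborel {-r..r} ^ card I"
      by simp
    also have "M * indicator {-r..r} a * \<dots> \<le> M * indicator {-r..r} a * ennreal (2 * \<bar>r\<bar>) ^ card I"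
      by (intro mult_left_mono power_mono) (auto simp: emeasure_lborel_Icc_eq)
    finally show ?thesis by (simp only: mult_ac)
  qed
  have "(\<integral>\<^sup>+x. F x \<partial>lborel) * (\<integral>\<^sup>+x. G x \<partial>lborel) \<le> (\<integral>\<^sup>+x. H x \<partial>lborel)\<^sup>2"
  proof (rule prekopa_leindler_1[where r = r])
    fix a b :: real
    assume ab: "\<bar>a\<bar> \<le> \<bar>b\<bar>"
    show "F b \<le> F a" "G b \<le> G a"
      unfolding F_def G_def using ab by (auto intro!: nn_integral_mono insert.prems(4,5))
  next
    fix a assume "\<bar>a\<bar> > r"
    then have "indicator {-r..r} a = (0::ennreal)" by (auto simp: indicator_def)
    then show "F a = 0" "G a = 0"
      using bound[of f a, OF insert.prems(7)] bound[of g a, OF insert.prems(8)] by (auto simp: F_def G_def)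
  next
    have "M * ennreal (2 * \<bar>r\<bar>) ^ card I * indicator {-r..r} (0::real) < \<infinity>"
      using insert.prems(6) by (simp add: ennreal_mult_less_top power_less_top_ennreal indicator_def)
    then show "F 0 < \<infinity>" "G 0 < \<infinity>"
      using bound[of f 0, OF insert.prems(7)] bound[of g 0, OF insert.prems(8)]
      by (auto simp: F_def G_def intro: le_less_trans)
  next
    fix a b :: real
    show "F a * G b \<le> (H ((a + b) / 2))\<^sup>2"
      unfolding F_def G_def H_def
    proof (rule insert.IH)
      show "(\<lambda>x. f (x(i := a))) \<in> borel_measurable ?P" "(\<lambda>x. g (x(i := b))) \<in> borel_measurable ?P"
        "(\<lambda>x. h (x(i := (a + b) / 2))) \<in> borel_measurable ?P" by measurable
    next
      fix x y :: "'i \<Rightarrow> real" assume "\<And>i. i \<in> I \<Longrightarrow> \<bar>x i\<bar> \<le> \<bar>y i\<bar>"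
      then show "f (y(i := a)) \<le> f (x(i := a))" "g (y(i := b)) \<le> g (x(i := b))"
        by (auto intro!: insert.prems(4,5))
    next
      have *: "M * (\<Prod>j\<in>insert i I. indicator {-r..r} ((x(i := c)) j)) \<le> M * (\<Prod>j\<in>I. indicator {-r..r} (x j))"
        for x and c :: real
      proof -
        have "(\<Prod>j\<in>I. indicator {-r..r} ((x(i := c)) j)) = (\<Prod>j\<in>I. indicator {-r..r} (x j) :: ennreal)"
          using insert(2) by (intro prod.cong) auto
        then show ?thesis using insert(1,2) 
          by (auto intro!: mult_left_mono simp: indicator_def)
      qed
      show "f (x(i := a)) \<le> M * (\<Prod>j\<in>I. indicator {-r..r} (x j))"
        "g (x(i := b)) \<le> M * (\<Prod>j\<in>I. indicator {-r..r} (x j))" for x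
        by (rule order_trans[OF insert.prems(7) *], rule order_trans[OF insert.prems(8) *])
    next
      fix x y :: "'i \<Rightarrow> real"
      have "(\<lambda>k. ((x(i := a)) k + (y(i := b)) k) / 2) = (\<lambda>i. (x i + y i) / 2)(i := (a + b) / 2)"
        by auto
      then show "f (x(i := a)) * g (y(i := b)) \<le> (h ((\<lambda>i. (x i + y i) / 2)(i := (a + b) / 2)))\<^sup>2"
        using insert.prems(9)[of "x(i := a)" "y(i := b)"] by (simp only:)
    qed (use insert.prems(6) in auto)
  qed measurable
  then show ?case
    unfolding F_def G_def H_def using insert(1,2)
    by (simp add: lborel_product.product_nn_integral_insert_rev)
qed

text \<open>
  Opening a gap of half-width \<open>c\<close> at the origin: the two halves of the line are translated outwards.
\<close>
lemma nn_integral_even_shift: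
  fixes \<phi> :: "real \<Rightarrow> ennreal"
  assumes [measurable]: "\<phi> \<in> borel_measurable borel" and even: "\<And>x. \<phi> (- x) = \<phi> x" and c: "c \<ge> 0"
  shows "(\<integral>\<^sup>+x. \<phi> (\<bar>x\<bar> + c) \<partial>lborel) = (\<integral>\<^sup>+x. \<phi> x * indicator {x. c \<le> \<bar>x\<bar>} x \<partial>lborel)"
proof -
  have "(\<integral>\<^sup>+x. \<phi> (\<bar>x\<bar> + c) \<partial>lborel) =
      (\<integral>\<^sup>+x. \<phi> (x + c) * indicator {0..} x + \<phi> (c - x) * indicator {..<0} x \<partial>lborel)"
    by (intro nn_integral_cong) (auto simp: indicator_def add.commute)
  also have "\<dots> = (\<integral>\<^sup>+x. \<phi> (x + c) * indicator {0..} x \<partial>lborel) + (\<integral>\<^sup>+x. \<phi> (c - x) * indicator {..<0} x \<partial>lborel)"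
    by (intro nn_integral_add) measurable
  also have "(\<integral>\<^sup>+x. \<phi> (x + c) * indicator {0..} x \<partial>lborel) = (\<integral>\<^sup>+x. \<phi> x * indicator {c..} x \<partial>lborel)"
    by (subst nn_integral_real_affine[where c = 1 and t = c and f = "\<lambda>x. \<phi> x * indicator {c..} x"])
       (auto intro!: nn_integral_cong simp: indicator_def add.commute)
  also have "(\<integral>\<^sup>+x. \<phi> (c - x) * indicator {..<0} x \<partial>lborel) = (\<integral>\<^sup>+x. \<phi> x * indicator {..< -c} x \<partial>lborel)"
    by (subst nn_integral_real_affine[where c = 1 and t = "-c" and f = "\<lambda>x. \<phi> x * indicator {..<-c} x"])
       (auto intro!: nn_integral_cong simp: indicator_def even[of "c - _", symmetric])
  also have "(\<integral>\<^sup>+x. \<phi> x * indicator {c..} x \<partial>lborel) + \<dots> =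
      (\<integral>\<^sup>+x. \<phi> x * indicator {c..} x + \<phi> x * indicator {..< -c} x \<partial>lborel)"
    by (intro nn_integral_add[symmetric]) measurable
  also have "\<dots> = (\<integral>\<^sup>+x. \<phi> x * indicator {x. c \<le> \<bar>x\<bar>} x \<partial>lborel)"
    using AE_lborel_singleton[of "-c"] c by (intro nn_integral_cong_AE) (auto elim!: eventually_mono simp: indicator_def)
  finally show ?thesis .
qed

section \<open>Unconditional bodies of volume 1\<close>

locale unconditional_body =
  fixes n :: nat and C :: "(nat \<Rightarrow> real) set"
  assumes convex_body: "convex_body n C" and unconditional: "unconditional n C"
    and volume: "measure (lborel_n n) C = 1"
begin

lemma compact: "compactin (powertop_real {..<n}) C"
  using convex_body by (simp add: convex_body_def)

lemma extensional: "x \<in> C \<Longrightarrow> x \<in> {..<n} \<rightarrow>\<^sub>E UNIV"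
  using compactin_subset_topspace[OF compact] by auto

lemma restrict_id: "x \<in> C \<Longrightarrow> restrict x {..<n} = x"
  using extensional by (auto simp: PiE_def extensional_restrict)

text \<open>
  A non-measurable set has measure 0, so the volume assumption carries measurability with it.
\<close>
lemma sets_C [measurable]: "C \<in> sets (lborel_n n)"
  using volume measure_notin_sets by fastforce

lemma emeasure_C: "emeasure (lborel_n n) C = 1"
  using volume by (metis emeasure_eq_ennreal_measure ennreal_1 measure_zero_top zero_neq_one)

lemma convex: "x \<in> C \<Longrightarrow> y \<in> C \<Longrightarrow> 0 \<le> u \<Longrightarrow> u \<le> 1 \<Longrightarrow> (\<lambda>i\<in>{..<n}. (1 - u) * x i + u * y i) \<in> C"
  using convex_body by (auto simp: convex_body_def)

lemma coordinates_bounded: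
  obtains r where "0 \<le> r" "\<And>x i. x \<in> C \<Longrightarrow> i < n \<Longrightarrow> \<bar>x i\<bar> \<le> r"
proof -
  have "\<exists>b. \<forall>x\<in>C. \<bar>x i\<bar> \<le> b" if "i < n" for i
  proof -
    have "compactin euclideanreal ((\<lambda>x. x i) ` C)"
      using that by (intro image_compactin[OF compact] continuous_map_product_projection) simp
    then have "bounded ((\<lambda>x. x i) ` C)"
      by (simp add: compact_imp_bounded)
    then show ?thesis by (auto simp: bounded_iff)
  qed
  then obtain b where b: "\<And>i x. i < n \<Longrightarrow> x \<in> C \<Longrightarrow> \<bar>x i\<bar> \<le> b i" by metis
  show ?thesis
  proof (rule that[of "\<Sum>i<n. \<bar>b i\<bar>"])
    fix x i assume "x \<in> C" "i < n"
    have "\<bar>x i\<bar> \<le> \<bar>b i\<bar>" using b[OF \<open>i < n\<close> \<open>x \<in> C\<close>] by simp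
    also have "\<dots> \<le> (\<Sum>i<n. \<bar>b i\<bar>)" using \<open>i < n\<close> by (intro member_le_sum) auto
    finally show "\<bar>x i\<bar> \<le> (\<Sum>i<n. \<bar>b i\<bar>)" .
  qed (simp add: sum_nonneg)
qed

text \<open>
  The coordinates of \<open>x\<close> are replaced by those of \<open>y\<close> one at a time. Each replacement is a convex
  combination of the current point and its reflection in that coordinate.
\<close>
lemma solid:
  assumes x: "x \<in> C" and y: "\<And>i. i < n \<Longrightarrow> \<bar>y i\<bar> \<le> \<bar>x i\<bar>"
  shows "restrict y {..<n} \<in> C"
proof -
  have "(\<lambda>i\<in>{..<n}. if i < m then y i else x i) \<in> C" if "m \<le> n" for m
    using that
  proof (induction m)
    case 0
    then show ?case using x restrict_id[OF x] by simp
  next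
    case (Suc m)
    define z where "z = (\<lambda>i\<in>{..<n}. if i < m then y i else x i)"
    define e where "e i = (if i = m then -1 else 1 :: real)" for i
    \<comment> \<open>\<open>u\<close> solves \<open>(1 - u) x\<^sub>m - u x\<^sub>m = y\<^sub>m\<close>.\<close>
    define u where "u = (if x m = 0 then 0 else (1 - y m / x m) / 2)"
    have z: "z \<in> C" unfolding z_def using Suc.prems by (intro Suc.IH) simp
    have "\<forall>i<n. e i \<in> {-1, 1}" by (simp add: e_def)
    with z have z': "(\<lambda>i\<in>{..<n}. e i * z i) \<in> C"
      using unconditional unfolding unconditional_def by blast
    have ym: "\<bar>y m\<bar> \<le> \<bar>x m\<bar>" using Suc.prems y by simp
    have "\<bar>y m / x m\<bar> \<le> 1" if "x m \<noteq> 0" using that ym by (simp add: abs_divide)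
    then have "x m \<noteq> 0 \<Longrightarrow> -1 \<le> y m / x m \<and> y m / x m \<le> 1" by linarith
    then have u: "0 \<le> u" "u \<le> 1" unfolding u_def by (auto split: if_splits)
    have "(\<lambda>i\<in>{..<n}. (1 - u) * z i + u * (\<lambda>i\<in>{..<n}. e i * z i) i) =
        (\<lambda>i\<in>{..<n}. if i < Suc m then y i else x i)"
    proof (intro restrict_ext)
      fix i assume i: "i \<in> {..<n}"
      show "(1 - u) * z i + u * (\<lambda>i\<in>{..<n}. e i * z i) i = (if i < Suc m then y i else x i)"
      proof (cases "i = m")
        case True
        have "(1 - 2 * u) * x m = y m" using ym by (auto simp: u_def field_simps)
        then show ?thesis using True i by (simp add: z_def e_def algebra_simps)
      next
        case False
        then show ?thesis using i by (auto simp: z_def e_def algebra_simps)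
      qed
    qed
    then show ?case using convex[OF z z' u] by (simp only:)
  qed
  moreover have "(\<lambda>i\<in>{..<n}. if i < n then y i else x i) = restrict y {..<n}"
    by (intro restrict_ext) simp
  ultimately show ?thesis by (metis order_refl)
qed

lemma midpoint: 
  assumes "x \<in> C" "y \<in> C" shows "(\<lambda>i\<in>{..<n}. (x i + y i) / 2) \<in> C"
proof -
  have "(\<lambda>i\<in>{..<n}. (x i + y i) / 2) = (\<lambda>i\<in>{..<n}. (1 - 1/2) * x i + 1/2 * y i)"
    by (intro restrict_ext) (simp add: field_simps)
  then show ?thesis using convex[OF assms, of "1/2"] by simp
qed

text \<open>
  The indicator of \<open>C\<close> composed with \<open>push i c\<close> is even and decreasing in every coordinate, and its
  integral is the volume of the part of \<open>C\<close> with \<open>\<bar>x\<^sub>i\<bar> \<ge> c\<close>. This brings tails, whose own indicators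
  increase along the \<open>i\<close>-th axis, within reach of the Prekopa-Leindler inequality.
\<close>
definition push :: "nat \<Rightarrow> real \<Rightarrow> (nat \<Rightarrow> real) \<Rightarrow> nat \<Rightarrow> real" where
  "push i c x = (\<lambda>k\<in>{..<n}. if k = i then \<bar>x k\<bar> + c else x k)"

lemma measurable_push [measurable]: "push i c \<in> measurable (lborel_n n) (lborel_n n)"
  unfolding push_def lborel_n_def
proof (rule measurable_restrict)
  fix k assume "k \<in> {..<n}"
  then have [measurable]: "(\<lambda>x. x k) \<in> borel_measurable (\<Pi>\<^sub>M i\<in>{..<n}. lborel)"
    by (simp add: measurable_component_singleton)
  have "(\<lambda>x. \<bar>x k\<bar> + c) \<in> borel_measurable (\<Pi>\<^sub>M i\<in>{..<n}. lborel)" by measurable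
  then show "(\<lambda>x. if k = i then \<bar>x k\<bar> + c else x k) \<in> measurable (\<Pi>\<^sub>M i\<in>{..<n}. lborel) lborel"
    by (cases "k = i") simp_all
qed

lemma nn_integral_push:
  assumes i: "i < n" and c: "0 \<le> c"
  shows "(\<integral>\<^sup>+x. indicator C (push i c x) \<partial>lborel_n n) = emeasure (lborel_n n) {x\<in>C. c \<le> \<bar>x i\<bar>}"
proof -
  define J where "J = {..<n} - {i}"
  have J: "finite J" "i \<notin> J" "insert i J = {..<n}" using i by (auto simp: J_def)
  let ?PJ = "\<Pi>\<^sub>M i\<in>J. (lborel :: real measure)"
  have L: "lborel_n n = (\<Pi>\<^sub>M i\<in>insert i J. lborel)" by (simp add: lborel_n_def J)
  have coord [measurable]: "(\<lambda>x. x i) \<in> borel_measurable (lborel_n n)"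
    unfolding lborel_n_def using i by (simp add: measurable_component_singleton)
  have S [measurable]: "{x\<in>C. c \<le> \<bar>x i\<bar>} \<in> sets (lborel_n n)"
  proof -
    have "{x\<in>C. c \<le> \<bar>x i\<bar>} = C \<inter> {x\<in>space (lborel_n n). c \<le> \<bar>x i\<bar>}"
      using sets.sets_into_space[OF sets_C] by auto
    then show ?thesis by simp
  qed
  have [measurable]: "C \<in> sets (\<Pi>\<^sub>M i\<in>insert i J. lborel)" using sets_C by (simp add: L)
  have "(\<integral>\<^sup>+x. indicator C (push i c x) \<partial>lborel_n n)
      = (\<integral>\<^sup>+x. (\<integral>\<^sup>+y. indicator C (push i c (x(i := y))) \<partial>lborel) \<partial>?PJ)"
    using measurable_push[of i c] unfolding L
    by (intro lborel_product.product_nn_integral_insert J) (simp_all add: L)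
  also have "\<dots> = (\<integral>\<^sup>+x. (\<integral>\<^sup>+y. indicator {x\<in>C. c \<le> \<bar>x i\<bar>} (x(i := y)) \<partial>lborel) \<partial>?PJ)"
  proof (rule nn_integral_cong)
    fix x assume x: "x \<in> space ?PJ"
    define \<phi> :: "real \<Rightarrow> ennreal" where "\<phi> y = indicator C (x(i := y))" for y
    have x_ext: "x k = undefined" if "k \<noteq> i" "\<not> k < n" for k
      using x that by (auto simp: space_PiM J_def PiE_def extensional_def)
    have "(\<lambda>y. x(i := y)) \<in> measurable lborel (\<Pi>\<^sub>M i\<in>insert i J. lborel)"
      using x J by (intro measurable_component_update)
    then have [measurable]: "\<phi> \<in> borel_measurable borel"
      unfolding \<phi>_def by measurable
    have flip: "x(i := - y) \<in> C" if "x(i := y) \<in> C" for y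
    proof -
      have "restrict (x(i := -y)) {..<n} \<in> C" by (rule solid[OF that]) simp
      also have "restrict (x(i := -y)) {..<n} = x(i := -y)" using x_ext i by (auto simp: restrict_def)
      finally show ?thesis .
    qed
    have even: "\<phi> (- y) = \<phi> y" for y
      using flip[of y] flip[of "- y"] by (auto simp: \<phi>_def indicator_def)
    have "push i c (x(i := y)) = x(i := \<bar>y\<bar> + c)" for y
      using x_ext i by (auto simp: push_def restrict_def)
    then have "(\<integral>\<^sup>+y. indicator C (push i c (x(i := y))) \<partial>lborel) = (\<integral>\<^sup>+y. \<phi> (\<bar>y\<bar> + c) \<partial>lborel)"
      by (simp add: \<phi>_def)
    also have "\<dots> = (\<integral>\<^sup>+y. \<phi> y * indicator {y. c \<le> \<bar>y\<bar>} y \<partial>lborel)"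
      by (rule nn_integral_even_shift) (use even c in auto)
    also have "\<dots> = (\<integral>\<^sup>+y. indicator {x\<in>C. c \<le> \<bar>x i\<bar>} (x(i := y)) \<partial>lborel)"
      by (intro nn_integral_cong) (auto simp: \<phi>_def indicator_def)
    finally show "(\<integral>\<^sup>+y. indicator C (push i c (x(i := y))) \<partial>lborel) = \<dots>" .
  qed
  also have "\<dots> = (\<integral>\<^sup>+x. indicator {x\<in>C. c \<le> \<bar>x i\<bar>} x \<partial>lborel_n n)"
    using S unfolding L
    by (intro lborel_product.product_nn_integral_insert[symmetric] J) simp
  finally show ?thesis using S by simp
qed

text \<open>
  Prekopa-Leindler for the pushes by \<open>2 a\<close>, \<open>0\<close> and \<open>a\<close>. By convexity the midpoint of a point pushed by
  \<open>2 a\<close> and a point pushed by \<open>0\<close> lies in \<open>C\<close>, and it dominates the midpoint of the originals pushed by \<open>a\<close>.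
  The volume of \<open>C\<close>, which is the integral for the push by 0, is 1.
\<close>
lemma emeasure_tail_double:
  assumes i: "i < n" and a: "0 \<le> a"
  shows "emeasure (lborel_n n) {x\<in>C. 2 * a \<le> \<bar>x i\<bar>} \<le> (emeasure (lborel_n n) {x\<in>C. a \<le> \<bar>x i\<bar>})\<^sup>2"
proof -
  obtain r where r: "0 \<le> r" "\<And>x i. x \<in> C \<Longrightarrow> i < n \<Longrightarrow> \<bar>x i\<bar> \<le> r"
    using coordinates_bounded by blast
  have push_mono: "indicator C (push i c y) \<le> (indicator C (push i c x) :: ennreal)"
    if "\<And>k. k \<in> {..<n} \<Longrightarrow> \<bar>x k\<bar> \<le> \<bar>y k\<bar>" "0 \<le> c" for x y c
  proof -
    have "push i c x \<in> C" if "push i c y \<in> C"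
    proof -
      have "restrict (push i c x) {..<n} \<in> C"
        by (rule solid[OF that]) (use \<open>0 \<le> c\<close> \<open>\<And>k. k \<in> {..<n} \<Longrightarrow> \<bar>x k\<bar> \<le> \<bar>y k\<bar>\<close> in \<open>auto simp: push_def\<close>)
      then show ?thesis by (simp add: push_def)
    qed
    then show ?thesis by (auto simp: indicator_def)
  qed
  have box: "indicator C (push i c x) \<le> 1 * (\<Prod>k\<in>{..<n}. indicator {-r..r} (x k) :: ennreal)"
    if "0 \<le> c" for c x
  proof (cases "push i c x \<in> C")
    case True
    have "\<bar>x k\<bar> \<le> r" if "k < n" for k
      using r(2)[OF True that] \<open>0 \<le> c\<close> that by (auto simp: push_def split: if_splits)
    then have "\<forall>k\<in>{..<n}. indicator {-r..r} (x k) = (1::ennreal)" by (auto simp: indicator_def abs_le_iff minus_le_iff)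
    then show ?thesis by (simp add: indicator_def)
  qed simp
  have "(\<integral>\<^sup>+x. indicator C (push i (2 * a) x) \<partial>(\<Pi>\<^sub>M i\<in>{..<n}. lborel)) *
      (\<integral>\<^sup>+x. indicator C (push i 0 x) \<partial>(\<Pi>\<^sub>M i\<in>{..<n}. lborel))
    \<le> (\<integral>\<^sup>+x. indicator C (push i a x) \<partial>(\<Pi>\<^sub>M i\<in>{..<n}. lborel))\<^sup>2"
  proof (rule prekopa_leindler_unconditional[where M = 1 and r = r])
    have "(\<lambda>x. indicator C (push i c x) :: ennreal) \<in> borel_measurable (lborel_n n)" for c
      by measurable
    then show "(\<lambda>x. indicator C (push i (2 * a) x) :: ennreal) \<in> borel_measurable (\<Pi>\<^sub>M i\<in>{..<n}. lborel)"
      "(\<lambda>x. indicator C (push i 0 x) :: ennreal) \<in> borel_measurable (\<Pi>\<^sub>M i\<in>{..<n}. lborel)"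
      "(\<lambda>x. indicator C (push i a x) :: ennreal) \<in> borel_measurable (\<Pi>\<^sub>M i\<in>{..<n}. lborel)"
      by (simp_all add: lborel_n_def)
  next
    fix x y
    have "push i a (\<lambda>i. (x i + y i) / 2) \<in> C" if "push i (2 * a) x \<in> C" "push i 0 y \<in> C"
    proof -
      have "restrict (push i a (\<lambda>i. (x i + y i) / 2)) {..<n} \<in> C"
      proof (rule solid[OF midpoint[OF that]])
        fix k assume k: "k < n"
        have "\<bar>(x i + y i) / 2\<bar> + a \<le> (\<bar>x i\<bar> + 2 * a + \<bar>y i\<bar>) / 2"
          using abs_triangle_ineq[of "x i" "y i"] by simp
        then show "\<bar>push i a (\<lambda>i. (x i + y i) / 2) k\<bar> \<le> \<bar>(\<lambda>k\<in>{..<n}. (push i (2 * a) x k + push i 0 y k) / 2) k\<bar>"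
          using k a by (auto simp: push_def)
      qed
      then show ?thesis by (simp add: push_def)
    qed
    then show "indicator C (push i (2 * a) x) * indicator C (push i 0 y)
        \<le> (indicator C (push i a (\<lambda>i. (x i + y i) / 2)) :: ennreal)\<^sup>2"
      by (auto simp: indicator_def)
  qed (use push_mono box a in auto)
  then show ?thesis
    using nn_integral_push[OF i] a emeasure_C by (simp flip: lborel_n_def)
qed

end

section \<open>Exponential integrability of coordinates\<close>

text \<open>
  The growth rate is chosen so that the exponential reaches \<open>2 ^ 2 ^ k\<close> at the end of the \<open>k\<close>-th dyadic
  block, half as fast in the exponent as the bound \<open>(1/4) ^ 2 ^ k\<close> for the tail decays.
\<close>
lemma exp_dyadic_bound:
  fixes a v :: real
  assumes "0 < a" "0 \<le> v" "v \<le> 2 ^ K * a"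
  shows "exp (ln 2 / (2 * a) * v) \<le> 2 + (\<Sum>k<K. 2 ^ (2 ^ k) * indicator {v. 2 ^ k * a \<le> v} v)"
  using assms(3)
proof (induction K)
  case 0
  have "ln 2 / (2 * a) * v \<le> ln 2 / (2 * a) * a"
    using 0 assms by (intro mult_left_mono) auto
  also have "\<dots> \<le> ln 2" using assms by simp
  finally show ?case by (simp add: ln_ge_iff[symmetric])
next
  case (Suc K)
  show ?case
  proof (cases "v \<le> 2 ^ K * a")
    case True
    with Suc.IH show ?thesis by (simp add: add.assoc[symmetric] add_increasing2)
  next
    case False
    have "ln 2 / (2 * a) * v \<le> ln 2 / (2 * a) * (2 ^ Suc K * a)"
      using Suc.prems assms by (intro mult_left_mono) auto
    also have "\<dots> = real (2 ^ K) * ln 2" using assms by simp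
    finally have "exp (ln 2 / (2 * a) * v) \<le> exp (real (2 ^ K) * ln 2)" by simp
    also have "\<dots> = 2 ^ (2 ^ K)" by (subst exp_of_nat_mult) simp
    also have "\<dots> \<le> 2 + (\<Sum>k<Suc K. 2 ^ (2 ^ k) * indicator {v. 2 ^ k * a \<le> v} v)"
      using False by (simp add: sum_nonneg)
    finally show ?thesis .
  qed
qed

lemma sum_half_powers: "(\<Sum>k<K. (1/2::real) ^ (2 ^ k)) \<le> 1"
proof -
  have "(\<Sum>k<K. (1/2::real) ^ (2 ^ k)) \<le> (\<Sum>k<K. (1/2) ^ Suc k)"
    by (intro sum_mono power_decreasing) (auto simp: Suc_le_eq)
  also have "\<dots> = 1 - (1/2) ^ K" by (induction K) auto
  also have "\<dots> \<le> 1" by simp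
  finally show ?thesis .
qed

context unconditional_body
begin

text \<open>
  Its space is \<open>C\<close> itself, so that inequalities valid at the points of \<open>C\<close> integrate without an
  almost-everywhere argument.
\<close>
definition uniform :: "(nat \<Rightarrow> real) measure" where
  "uniform = restrict_space (lborel_n n) C"

lemma space_uniform: "space uniform = C"
  using sets.sets_into_space[OF sets_C] by (auto simp: uniform_def space_restrict_space)

lemma measurable_uniform: "f \<in> measurable (lborel_n n) N \<Longrightarrow> f \<in> measurable uniform N"
  unfolding uniform_def by (rule measurable_restrict_space1)

lemma measurable_coordinate [measurable]: "i < n \<Longrightarrow> (\<lambda>x. x i) \<in> borel_measurable uniform"
  by (rule measurable_uniform) (simp add: lborel_n_def measurable_component_singleton)

lemma integral_uniform: "integral\<^sup>L uniform f = (LINT x:C|lborel_n n. f x)" for f :: "_ \<Rightarrow> real"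
  unfolding uniform_def set_lebesgue_integral_def by (rule integral_restrict_space) simp

lemma integrable_uniform: "integrable uniform f \<longleftrightarrow> integrable (lborel_n n) (\<lambda>x. indicator C x *\<^sub>R f x)" for f :: "_ \<Rightarrow> real"
  unfolding uniform_def by (rule integrable_restrict_space) simp

lemma emeasure_uniform: "A \<subseteq> C \<Longrightarrow> emeasure uniform A = emeasure (lborel_n n) A"
  unfolding uniform_def by (rule emeasure_restrict_space) auto

sublocale prob_space uniform
  by standard (simp add: space_uniform emeasure_uniform emeasure_C)

text \<open>
  A continuous function of one coordinate is bounded on \<open>C\<close>, which is compact.
\<close>
lemma integrable_coordinate:
  fixes F :: "real \<Rightarrow> real"
  assumes i: "i < n" and F: "continuous_on UNIV F"
  shows "integrable uniform (\<lambda>x. F (x i))"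
proof -
  obtain r where r: "0 \<le> r" "\<And>x i. x \<in> C \<Longrightarrow> i < n \<Longrightarrow> \<bar>x i\<bar> \<le> r"
    using coordinates_bounded by blast
  have "compact (F ` {-r..r})"
    using F by (intro compact_continuous_image) (auto intro: continuous_on_subset)
  then obtain B where B: "\<And>v. v \<in> {-r..r} \<Longrightarrow> \<bar>F v\<bar> \<le> B"
    by (force dest!: compact_imp_bounded simp: bounded_iff)
  have [measurable]: "F \<in> borel_measurable borel" using F by (rule borel_measurable_continuous_onI)
  show ?thesis
  proof (rule integrable_const_bound[where B = B])
    show "AE x in uniform. norm (F (x i)) \<le> B"
      using B r(2) i by (auto simp: space_uniform abs_le_iff minus_le_iff intro!: AE_I2)
    show "(\<lambda>x. F (x i)) \<in> borel_measurable uniform"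
      using i by measurable
  qed
qed

lemma prob_tail_double:
  assumes i: "i < n" and a: "0 \<le> a"
  shows "prob {x\<in>C. 2 * a \<le> \<bar>x i\<bar>} \<le> (prob {x\<in>C. a \<le> \<bar>x i\<bar>})\<^sup>2"
proof -
  have "ennreal (prob {x\<in>C. 2 * a \<le> \<bar>x i\<bar>}) \<le> ennreal ((prob {x\<in>C. a \<le> \<bar>x i\<bar>})\<^sup>2)"
    using emeasure_tail_double[OF assms]
    by (simp add: emeasure_eq_measure emeasure_uniform[symmetric] ennreal_power)
  then show ?thesis by simp
qed

definition mean_abs :: "nat \<Rightarrow> real" where
  "mean_abs i = expectation (\<lambda>x. \<bar>x i\<bar>)"

lemma mean_abs_nonneg: "0 \<le> mean_abs i"
  by (simp add: mean_abs_def)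

lemma integrable_abs: "i < n \<Longrightarrow> integrable uniform (\<lambda>x. \<bar>x i\<bar>)"
  by (rule integrable_coordinate) (auto intro!: continuous_intros)

lemma integrable_square: "i < n \<Longrightarrow> integrable uniform (\<lambda>x. (x i)\<^sup>2)"
  by (rule integrable_coordinate[where F = "\<lambda>x. x\<^sup>2"]) (auto intro!: continuous_intros)

text \<open>
  Markov's inequality gives the start, and doubling the argument squares the probability.
\<close>
lemma prob_tail_dyadic:
  assumes i: "i < n" and M: "0 < mean_abs i"
  shows "prob {x\<in>C. 2 ^ k * (4 * mean_abs i) \<le> \<bar>x i\<bar>} \<le> (1/4) ^ (2 ^ k)"
proof (induction k)
  case 0
  have "prob {x\<in>space uniform. 4 * mean_abs i \<le> \<bar>x i\<bar>} \<le> expectation (\<lambda>x. \<bar>x i\<bar>) / (4 * mean_abs i)"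
    using M integrable_abs[OF i] by (intro integral_Markov_inequality_measure[where A = "{}"]) auto
  then show ?case using M by (simp add: mean_abs_def space_uniform)
next
  case (Suc k)
  have "prob {x\<in>C. 2 ^ Suc k * (4 * mean_abs i) \<le> \<bar>x i\<bar>} \<le> (prob {x\<in>C. 2 ^ k * (4 * mean_abs i) \<le> \<bar>x i\<bar>})\<^sup>2"
    using prob_tail_double[OF i, of "2 ^ k * (4 * mean_abs i)"] M by (simp add: mult.assoc)
  also have "\<dots> \<le> ((1/4) ^ (2 ^ k))\<^sup>2" by (intro power_mono Suc) simp
  also have "\<dots> = (1/4) ^ (2 ^ Suc k)" by (simp add: power_mult[symmetric] mult.commute)
  finally show ?case .
qed

lemma exp_moment:
  assumes i: "i < n" and M: "0 < mean_abs i"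
  shows "expectation (\<lambda>x. exp (ln 2 / (8 * mean_abs i) * \<bar>x i\<bar>)) \<le> 3"
proof -
  define a where "a = 4 * mean_abs i"
  have a: "a > 0" "8 * mean_abs i = 2 * a" using M by (auto simp: a_def)
  obtain r where r: "0 \<le> r" "\<And>x i. x \<in> C \<Longrightarrow> i < n \<Longrightarrow> \<bar>x i\<bar> \<le> r"
    using coordinates_bounded by blast
  \<comment> \<open>Coordinates are bounded on \<open>C\<close>, so finitely many dyadic blocks cover their range.\<close>
  obtain K where K: "r / a < 2 ^ K" using real_arch_pow[of 2 "r / a"] by auto
  define E where "E k = {x\<in>C. 2 ^ k * a \<le> \<bar>x i\<bar>}" for k :: nat
  have E [measurable]: "E k \<in> events" for k
  proof -
    have "{x\<in>space uniform. 2 ^ k * a \<le> \<bar>x i\<bar>} \<in> events" using i by measurable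
    then show ?thesis by (simp add: E_def space_uniform)
  qed
  have pE: "prob (E k) \<le> (1/4) ^ (2 ^ k)" for k
    using prob_tail_dyadic[OF assms] by (simp add: E_def a_def)
  have I: "integrable uniform (\<lambda>x. 2 ^ (2 ^ k) * indicator (E k) x :: real)" for k
    by (intro integrable_mult_right integrable_real_indicator E) (simp add: less_top[symmetric])
  then have int: "integrable uniform (\<lambda>x. 2 + (\<Sum>k<K. 2 ^ (2 ^ k) * indicator (E k) x) :: real)"
    by (intro Bochner_Integration.integrable_add Bochner_Integration.integrable_sum integrable_const) auto
  have "expectation (\<lambda>x. exp (ln 2 / (8 * mean_abs i) * \<bar>x i\<bar>))
      \<le> expectation (\<lambda>x. 2 + (\<Sum>k<K. 2 ^ (2 ^ k) * indicator (E k) x))"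
  proof (rule integral_mono)
    show "integrable uniform (\<lambda>x. exp (ln 2 / (8 * mean_abs i) * \<bar>x i\<bar>))"
      by (rule integrable_coordinate[OF i]) (use M in \<open>auto intro!: continuous_intros\<close>)
    fix x assume "x \<in> space uniform"
    then have x: "x \<in> C" by (simp add: space_uniform)
    have "\<bar>x i\<bar> \<le> r" using r(2) x i by simp
    also have "r \<le> 2 ^ K * a" using K a by (simp add: field_simps)
    finally have "exp (ln 2 / (2 * a) * \<bar>x i\<bar>) \<le> 2 + (\<Sum>k<K. 2 ^ (2 ^ k) * indicator {v. 2 ^ k * a \<le> v} \<bar>x i\<bar>)"
      using a by (intro exp_dyadic_bound) auto
    also have "(\<Sum>k<K. 2 ^ (2 ^ k) * indicator {v. 2 ^ k * a \<le> v} \<bar>x i\<bar>) = (\<Sum>k<K. 2 ^ (2 ^ k) * indicator (E k) x :: real)"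
      using x by (intro sum.cong) (auto simp: E_def indicator_def)
    finally show "exp (ln 2 / (8 * mean_abs i) * \<bar>x i\<bar>) \<le> 2 + (\<Sum>k<K. 2 ^ (2 ^ k) * indicator (E k) x)"
      by (simp add: a)
  qed (rule int)
  also have "\<dots> = expectation (\<lambda>x. 2) + expectation (\<lambda>x. \<Sum>k<K. 2 ^ (2 ^ k) * indicator (E k) x)"
    by (rule Bochner_Integration.integral_add[OF integrable_const Bochner_Integration.integrable_sum[OF I]])
  also have "expectation (\<lambda>x. \<Sum>k<K. 2 ^ (2 ^ k) * indicator (E k) x) = (\<Sum>k<K. expectation (\<lambda>x. 2 ^ (2 ^ k) * indicator (E k) x :: real))"
    by (rule Bochner_Integration.integral_sum[OF I])
  also have "expectation (\<lambda>x. 2) + \<dots> = 2 + (\<Sum>k<K. 2 ^ (2 ^ k) * prob (E k))"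
    by (simp add: prob_space)
  also have "\<dots> \<le> 2 + (\<Sum>k<K. (1/2) ^ (2 ^ k))"
  proof (intro add_left_mono sum_mono)
    fix k
    have "(2::real) ^ (2 ^ k) * prob (E k) \<le> 2 ^ (2 ^ k) * (1/4) ^ (2 ^ k)"
      by (intro mult_left_mono pE) simp
    also have "\<dots> = (1/2) ^ (2 ^ k)" by (simp add: power_mult_distrib[symmetric])
    finally show "(2::real) ^ (2 ^ k) * prob (E k) \<le> (1/2) ^ (2 ^ k)" .
  qed
  also have "\<dots> \<le> 3" using sum_half_powers[of K] by simp
  finally show ?thesis .
qed

text \<open>
  A quadratic is dominated by the exponential, so \<open>exp_moment\<close> gives a reverse Cauchy-Schwarz inequality.
  It is the estimate that makes first and second moments interchangeable up to constants.
\<close>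
lemma second_moment_le:
  assumes i: "i < n" and M: "0 < mean_abs i"
  shows "expectation (\<lambda>x. (x i)\<^sup>2) \<le> 900 * (mean_abs i)\<^sup>2"
proof -
  define \<eta> where "\<eta> = ln 2 / (8 * mean_abs i)"
  have \<eta>: "\<eta> > 0" using M by (simp add: \<eta>_def)
  have "\<eta>\<^sup>2 / 2 * expectation (\<lambda>x. (x i)\<^sup>2) = expectation (\<lambda>x. \<eta>\<^sup>2 / 2 * (x i)\<^sup>2)" by simp
  also have "\<dots> \<le> expectation (\<lambda>x. exp (\<eta> * \<bar>x i\<bar>))"
  proof (rule integral_mono)
    show "integrable uniform (\<lambda>x. exp (\<eta> * \<bar>x i\<bar>))"
      by (rule integrable_coordinate[OF i]) (auto intro!: continuous_intros)
    fix x
    show "\<eta>\<^sup>2 / 2 * (x i)\<^sup>2 \<le> exp (\<eta> * \<bar>x i\<bar>)"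
    proof -
      define w where "w = \<eta> * \<bar>x i\<bar>"
      have "0 \<le> w" using \<eta> by (simp add: w_def)
      with exp_lower_Taylor_quadratic[of w] have "w\<^sup>2 / 2 \<le> exp w" by simp
      moreover have "w\<^sup>2 / 2 = \<eta>\<^sup>2 / 2 * (x i)\<^sup>2" by (simp add: w_def power_mult_distrib)
      ultimately show ?thesis by (simp only: w_def)
    qed
  qed (use integrable_square[OF i] in auto)
  also have "\<dots> \<le> 3" using exp_moment[OF assms] by (simp add: \<eta>_def)
  finally have "expectation (\<lambda>x. (x i)\<^sup>2) \<le> 6 / \<eta>\<^sup>2" using \<eta> by (simp add: field_simps)
  also have "\<dots> = 384 * (mean_abs i)\<^sup>2 / (ln 2)\<^sup>2" by (simp add: \<eta>_def power_divide power_mult_distrib)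
  also have "\<dots> \<le> 384 * (mean_abs i)\<^sup>2 / (2/3)\<^sup>2"
    using ln2_ge_two_thirds by (intro divide_left_mono power_mono mult_pos_pos) auto
  also have "\<dots> = 864 * (mean_abs i)\<^sup>2" by (simp add: power2_eq_square)
  \<comment> \<open>Rounded up to a perfect square.\<close>
  also have "\<dots> \<le> 900 * (mean_abs i)\<^sup>2" by (intro mult_right_mono) auto
  finally show ?thesis .
qed

lemma mean_abs_sq_le:
  assumes i: "i < n"
  shows "(mean_abs i)\<^sup>2 \<le> expectation (\<lambda>x. (x i)\<^sup>2)"
proof -
  have "0 \<le> expectation (\<lambda>x. (\<bar>x i\<bar> - mean_abs i)\<^sup>2)" by simp
  also have "\<dots> = expectation (\<lambda>x. (x i)\<^sup>2 - 2 * mean_abs i * \<bar>x i\<bar> + (mean_abs i)\<^sup>2)"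
    by (simp add: power2_diff algebra_simps)
  also have "\<dots> = expectation (\<lambda>x. (x i)\<^sup>2) - 2 * mean_abs i * mean_abs i + (mean_abs i)\<^sup>2"
    using integrable_abs[OF i] integrable_square[OF i] by (simp add: prob_space mean_abs_def)
  finally show ?thesis by (simp add: power2_eq_square)
qed

lemma mean_abs_pos:
  assumes i: "i < n" and pos: "0 < expectation (\<lambda>x. (x i)\<^sup>2)"
  shows "0 < mean_abs i"
proof (rule ccontr)
  assume "\<not> 0 < mean_abs i"
  then have "expectation (\<lambda>x. \<bar>x i\<bar>) = 0" using mean_abs_nonneg[of i] unfolding mean_abs_def by linarith
  then have "AE x in uniform. \<bar>x i\<bar> = 0"
    using integral_nonneg_eq_0_iff_AE[OF integrable_abs[OF i]] by simp
  then have "AE x in uniform. (x i)\<^sup>2 = 0" by auto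
  then have "expectation (\<lambda>x. (x i)\<^sup>2) = expectation (\<lambda>x. 0)"
    using i by (intro integral_cong_AE) auto
  then show False using pos by simp
qed

end

section \<open>The vector of mean absolute values\<close>

context unconditional_body
begin

text \<open>
  Let \<open>p\<close> be the point of \<open>C\<close> nearest to the vector \<open>M\<close> of means. Since \<open>C\<close> is convex and contains \<open>\<bar>x\<bar>\<close>
  along with \<open>x\<close>, the inner product of \<open>M - p\<close> and \<open>\<bar>x\<bar> - p\<close> is at most 0 for every \<open>x\<close> in \<open>C\<close>. Averaging this over
  \<open>x\<close> replaces \<open>\<bar>x\<bar>\<close> by \<open>M\<close> and leaves \<open>\<parallel>M - p\<parallel>\<^sup>2 \<le> 0\<close>.
\<close>
lemma mean_abs_in_body: "restrict mean_abs {..<n} \<in> C"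
proof -
  define D where "D x = (\<Sum>i<n. (mean_abs i - x i)\<^sup>2)" for x :: "nat \<Rightarrow> real"
  have "continuous_map (powertop_real {..<n}) euclideanreal D"
    unfolding D_def
    by (intro continuous_map_sum continuous_map_real_pow continuous_map_diff continuous_map_product_projection) auto
  then have "compactin euclideanreal (D ` C)" by (rule image_compactin[OF compact])
  moreover have "C \<noteq> {}" using emeasure_C by auto
  ultimately obtain p where p: "p \<in> C" "\<And>x. x \<in> C \<Longrightarrow> D p \<le> D x"
    using compact_attains_inf[of "D ` C"] by auto
  have obtuse: "(\<Sum>i<n. (mean_abs i - p i) * (\<bar>x i\<bar> - p i)) \<le> 0" if x: "x \<in> C" for x
  proof (rule ccontr)
    define S where "S = (\<Sum>i<n. (mean_abs i - p i) * (\<bar>x i\<bar> - p i))"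
    define Q where "Q = (\<Sum>i<n. (\<bar>x i\<bar> - p i)\<^sup>2)"
    assume "\<not> ?thesis"
    then have S: "S > 0" by (simp add: S_def)
    have Q: "Q \<ge> 0" by (simp add: Q_def sum_nonneg)
    \<comment> \<open>A step this short along the segment from \<open>p\<close> to \<open>\<bar>x\<bar>\<close> keeps the quadratic term below the linear one.\<close>
    define u where "u = min 1 (S / (Q + 1))"
    have u: "0 < u" "u \<le> 1" using S Q by (auto simp: u_def)
    have abs_x: "restrict (\<lambda>i. \<bar>x i\<bar>) {..<n} \<in> C" by (rule solid[OF x]) simp
    have "D p \<le> D (\<lambda>i\<in>{..<n}. (1 - u) * p i + u * restrict (\<lambda>i. \<bar>x i\<bar>) {..<n} i)"
      using u by (intro p(2) convex[OF p(1) abs_x]) auto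
    also have "\<dots> = (\<Sum>i<n. (mean_abs i - p i)\<^sup>2 - 2 * u * ((mean_abs i - p i) * (\<bar>x i\<bar> - p i)) + u\<^sup>2 * (\<bar>x i\<bar> - p i)\<^sup>2)"
      unfolding D_def by (intro sum.cong) (auto simp: power2_eq_square algebra_simps)
    also have "\<dots> = D p - 2 * u * S + u\<^sup>2 * Q"
      by (simp add: D_def S_def Q_def sum.distrib sum_subtractf sum_distrib_left)
    finally have "u * (2 * S) \<le> u * (u * Q)" by (simp add: power2_eq_square mult_ac)
    then have "2 * S \<le> u * Q" using u by simp
    also have "u * Q \<le> S / (Q + 1) * Q" using Q by (intro mult_right_mono) (auto simp: u_def)
    also have "\<dots> \<le> S" using S Q by (simp add: field_simps)
    finally show False using S by simp
  qed
  have "(\<Sum>i<n. (mean_abs i - p i)\<^sup>2) = expectation (\<lambda>x. \<Sum>i<n. (mean_abs i - p i) * (\<bar>x i\<bar> - p i))"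
    using integrable_abs by (simp add: prob_space mean_abs_def power2_eq_square)
  also have "\<dots> \<le> 0"
  proof -
    have "expectation (\<lambda>x. \<Sum>i<n. (mean_abs i - p i) * (\<bar>x i\<bar> - p i)) \<le> expectation (\<lambda>x. 0)"
      using integrable_abs obtuse by (intro integral_mono) (auto simp: space_uniform)
    then show ?thesis by simp
  qed
  finally have "(\<Sum>i<n. (mean_abs i - p i)\<^sup>2) = 0" by (intro antisym sum_nonneg) auto
  then have "\<forall>i<n. mean_abs i = p i" by (simp add: sum_nonneg_eq_0_iff)
  then have "restrict mean_abs {..<n} = restrict p {..<n}" by (intro restrict_ext) simp
  then show ?thesis using p(1) restrict_id by metis
qed

text \<open>
  The product is the volume of the box spanned by the point \<open>M\<close> of \<open>C\<close> and its reflections, which \<open>C\<close>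
  contains.
\<close>
lemma prod_mean_abs_le_1: "(\<Prod>i<n. 2 * mean_abs i) \<le> 1"
proof -
  have "emeasure (lborel_n n) (\<Pi>\<^sub>E i\<in>{..<n}. {- mean_abs i..mean_abs i}) \<le> emeasure (lborel_n n) C"
  proof (intro emeasure_mono subsetI sets_C)
    fix x assume x: "x \<in> (\<Pi>\<^sub>E i\<in>{..<n}. {- mean_abs i..mean_abs i})"
    have "restrict x {..<n} \<in> C"
    proof (rule solid[OF mean_abs_in_body])
      fix i assume "i < n"
      then show "\<bar>x i\<bar> \<le> \<bar>restrict mean_abs {..<n} i\<bar>"
        using PiE_mem[OF x, of i] mean_abs_nonneg[of i] by (simp add: abs_le_iff)
    qed
    moreover have "restrict x {..<n} = x" using x by (auto simp: PiE_def extensional_restrict)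
    ultimately show "x \<in> C" by simp
  qed
  also have "emeasure (lborel_n n) (\<Pi>\<^sub>E i\<in>{..<n}. {- mean_abs i..mean_abs i})
      = (\<Prod>i<n. emeasure lborel {- mean_abs i..mean_abs i})"
    unfolding lborel_n_def by (intro lborel_product.emeasure_PiM) auto
  also have "\<dots> = (\<Prod>i<n. ennreal (2 * mean_abs i))"
    by (intro prod.cong refl) (use mean_abs_nonneg in simp)
  also have "\<dots> = ennreal (\<Prod>i<n. 2 * mean_abs i)"
    by (intro prod_ennreal) (simp add: mean_abs_nonneg)
  finally have "ennreal (\<Prod>i<n. 2 * mean_abs i) \<le> ennreal 1" by (simp add: emeasure_C)
  then show ?thesis by (simp only: ennreal_le_iff zero_le_one)
qed

text \<open>
  Jensen's inequality, by integrating the tangent of \<open>exp\<close> at the mean of \<open>W\<close>.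
\<close>
lemma jensen_exp:
  fixes W :: "(nat \<Rightarrow> real) \<Rightarrow> real"
  assumes "integrable uniform W" "integrable uniform (\<lambda>x. exp (W x))"
  shows "exp (expectation W) \<le> expectation (\<lambda>x. exp (W x))"
proof -
  define m where "m = expectation W"
  have "exp m = expectation (\<lambda>x. exp m * (1 + (W x - m)))"
    using assms by (simp add: prob_space m_def)
  also have "\<dots> \<le> expectation (\<lambda>x. exp (W x))"
  proof (rule integral_mono)
    fix x
    have "exp m * (1 + (W x - m)) \<le> exp m * exp (W x - m)"
      by (intro mult_left_mono exp_ge_add_one_self) simp
    then show "exp m * (1 + (W x - m)) \<le> exp (W x)" by (simp add: exp_add[symmetric])
  qed (use assms in auto)
  finally show ?thesis by (simp add: m_def)
qed

text \<open>
  A body of volume 1 cannot concentrate near the origin. The integral over \<open>C\<close> of the centred Gaussian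
  density with variance \<open>1/25\<close> is at most 1, while Jensen's inequality bounds it from below in terms of
  the second moments. The variance is taken so small that the density at the origin is at least
  \<open>exp (n / 2)\<close>.
\<close>
lemma sum_second_moments_ge: "real n / 25 \<le> (\<Sum>i<n. expectation (\<lambda>x. (x i)\<^sup>2))"
proof -
  define W where "W x = (\<Sum>i<n. -(25/2) * (x i)\<^sup>2)" for x :: "nat \<Rightarrow> real"
  define \<kappa> where "\<kappa> = 1 / sqrt (2 * pi * (1/5)\<^sup>2)"
  have \<kappa>: "0 < \<kappa>" by (simp add: \<kappa>_def)
  have dens: "normal_density 0 (1/5) v = \<kappa> * exp (-(25/2) * v\<^sup>2)" for v
    by (simp add: normal_density_def \<kappa>_def power2_eq_square)
  have prod: "(\<Prod>i<n. normal_density 0 (1/5) (x i)) = \<kappa> ^ n * exp (W x)" for x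
    by (simp add: dens prod.distrib W_def exp_sum)
  \<comment> \<open>Equivalent to \<open>2 * pi * e / 25 \<le> 1\<close>; the crude bounds \<open>e \<le> 3\<close> and \<open>pi \<le> 4\<close> suffice.\<close>
  have \<kappa>_ge: "exp (1/2) \<le> \<kappa>"
  proof -
    have "exp 1 * (2 * pi * (1/5)\<^sup>2) \<le> 3 * (2 * 4 * (1/5)\<^sup>2)"
      using pi_less_4 exp_le by (intro mult_mono) auto
    also have "\<dots> \<le> 1" by (simp add: power2_eq_square)
    finally have "sqrt (exp 1 * (2 * pi * (1/5)\<^sup>2)) \<le> 1" by simp
    moreover have "sqrt (exp (1::real)) = exp (1/2)"
      by (intro real_sqrt_unique) (auto simp: exp_double[symmetric])
    ultimately have "exp (1/2) * sqrt (2 * pi * (1/5)\<^sup>2) \<le> 1" by (simp only: real_sqrt_mult)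
    then show ?thesis unfolding \<kappa>_def by (subst le_divide_eq) auto
  qed
  have intW: "integrable uniform W"
    unfolding W_def using integrable_square by auto
  have mW: "(\<lambda>x. exp (W x)) \<in> borel_measurable uniform" using intW by measurable
  have intE: "integrable uniform (\<lambda>x. exp (W x))"
    by (rule integrable_const_bound[where B = 1]) (use mW in \<open>auto simp: W_def sum_nonneg intro!: sum_nonpos\<close>)
  have "ennreal (\<kappa> ^ n * expectation (\<lambda>x. exp (W x))) = (\<integral>\<^sup>+x. ennreal (\<kappa> ^ n * exp (W x)) \<partial>uniform)"
    using intE \<kappa> by (subst nn_integral_eq_integral) auto
  also have "\<dots> = (\<integral>\<^sup>+x. (\<Prod>i<n. ennreal (normal_density 0 (1/5) (x i))) * indicator C x \<partial>lborel_n n)"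
    unfolding uniform_def by (subst nn_integral_restrict_space) (auto simp: prod[symmetric] prod_ennreal)
  also have "\<dots> \<le> (\<integral>\<^sup>+x. (\<Prod>i<n. ennreal (normal_density 0 (1/5) (x i))) \<partial>lborel_n n)"
    by (intro nn_integral_mono) (auto simp: indicator_def)
  also have "\<dots> = (\<Prod>i<n. \<integral>\<^sup>+v. ennreal (normal_density 0 (1/5) v) \<partial>lborel)"
    unfolding lborel_n_def by (intro lborel_product.product_nn_integral_prod) auto
  also have "\<dots> = 1"
    by (subst nn_integral_eq_integral) auto
  finally have le1: "\<kappa> ^ n * expectation (\<lambda>x. exp (W x)) \<le> 1" 
    by (simp add: ennreal_le_1)
  have EW: "expectation W = -(25/2) * (\<Sum>i<n. expectation (\<lambda>x. (x i)\<^sup>2))"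
    unfolding W_def using integrable_square by (simp add: sum_distrib_left)
  have "exp (real n / 2 + expectation W) = exp (1/2) ^ n * exp (expectation W)"
    by (simp add: exp_add exp_of_nat_mult[symmetric])
  also have "\<dots> \<le> \<kappa> ^ n * expectation (\<lambda>x. exp (W x))"
    using jensen_exp[OF intW intE] \<kappa>_ge \<kappa> by (intro mult_mono power_mono) auto
  also have "\<dots> \<le> exp 0" using le1 by simp
  finally show ?thesis unfolding EW by (subst (asm) exp_le_cancel_iff) simp
qed

end

section \<open>Isotropic unconditional bodies\<close>

locale isotropic_unconditional_body = unconditional_body +
  assumes isotropic: "isotropic n C"
begin

lemma expectation_coordinate: "i < n \<Longrightarrow> expectation (\<lambda>x. x i) = 0"
  using isotropic by (simp add: isotropic_def integral_uniform)

lemma equal_second_moments: "\<exists>V>0. \<forall>i<n. expectation (\<lambda>x. (x i)\<^sup>2) = V"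
proof -
  obtain L where L: "L > 0" "\<And>\<xi>. L2_set \<xi> {..<n} = 1 \<Longrightarrow> expectation (\<lambda>x. (\<Sum>i<n. x i * \<xi> i)\<^sup>2) = L\<^sup>2"
    using isotropic by (auto simp: isotropic_def integral_uniform)
  have "expectation (\<lambda>x. (x i)\<^sup>2) = L\<^sup>2" if i: "i < n" for i
  proof -
    have "L2_set (\<lambda>k. if k = i then 1 else 0) {..<n} = 1"
      using i by (simp add: L2_set_def if_distrib[of "\<lambda>x. x\<^sup>2"] cong: if_cong)
    from L(2)[OF this] show ?thesis using i by (simp add: if_distrib cong: if_cong)
  qed
  then show ?thesis using L(1) by (intro exI[of _ "L\<^sup>2"]) simp
qed

text \<open>
  Let \<open>V\<close> be the common second moment. Each \<open>M\<^sub>i\<close> lies between \<open>sqrt V / 30\<close> and \<open>sqrt V\<close>. The Gaussian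
  comparison gives \<open>V \<ge> 1/25\<close>, and the box of side lengths \<open>2 M\<^sub>i \<ge> sqrt V / 15\<close> has volume at most 1.
\<close>
lemma mean_abs_bounds:
  assumes i: "i < n"
  shows "1 / 150 \<le> mean_abs i" "mean_abs i \<le> 15"
proof -
  obtain V where V: "V > 0" "\<And>i. i < n \<Longrightarrow> expectation (\<lambda>x. (x i)\<^sup>2) = V"
    using equal_second_moments by blast
  have n: "n > 0" using i by simp
  have ge: "sqrt V / 30 \<le> mean_abs k" if k: "k < n" for k
  proof -
    have "V \<le> (30 * mean_abs k)\<^sup>2"
      using second_moment_le[OF k] mean_abs_pos[OF k] V k by (simp add: power_mult_distrib)
    then have "sqrt V \<le> 30 * mean_abs k" using mean_abs_nonneg[of k] by (intro real_le_lsqrt) auto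
    then show ?thesis by simp
  qed
  have "real n / 25 \<le> real n * V" using sum_second_moments_ge V(2) by simp
  then have "1 / 25 \<le> V" using n by simp
  then have "sqrt ((1 / 5)\<^sup>2) \<le> sqrt V" by (intro real_sqrt_le_mono) (simp add: power2_eq_square)
  then show "1 / 150 \<le> mean_abs i" using ge[OF i] by simp
  have "(sqrt V / 15) ^ n = (\<Prod>k<n. 2 * (sqrt V / 30))" by simp
  also have "\<dots> \<le> (\<Prod>k<n. 2 * mean_abs k)"
  proof (rule prod_mono)
    fix k assume "k \<in> {..<n}"
    then show "0 \<le> 2 * (sqrt V / 30) \<and> 2 * (sqrt V / 30) \<le> 2 * mean_abs k"
      using ge[of k] V(1) by simp
  qed
  also have "\<dots> \<le> 1" by (rule prod_mean_abs_le_1)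
  finally have "sqrt V / 15 \<le> 1" using n by (meson linorder_not_le one_less_power)
  moreover have "mean_abs i \<le> sqrt V"
    using mean_abs_sq_le[OF i] V(2)[OF i] by (intro real_le_rsqrt) simp
  ultimately show "mean_abs i \<le> 15" by simp
qed

text \<open>
  By Taylor's formula \<open>exp (l y)\<close> exceeds \<open>1 + l y\<close> by at most \<open>l\<^sup>2\<close> times a function that is dominated by
  \<open>exp (\<bar>y\<bar> / 180)\<close>. The linear term integrates to zero because the barycenter is the origin, and the
  rate \<open>1/180\<close> is admissible in \<open>exp_moment\<close> because \<open>M\<^sub>i \<le> 15\<close>.
\<close>
lemma mgf_coordinate:
  assumes i: "i < n" and l: "\<bar>l\<bar> \<le> 1 / 360"
  shows "expectation (\<lambda>x. exp (l * x i)) \<le> exp (388800 * l\<^sup>2)"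
proof -
  have int: "integrable uniform (\<lambda>x. exp (c * \<bar>x i\<bar>))" "integrable uniform (\<lambda>x. x i)" "integrable uniform (\<lambda>x. exp (c * x i))" for c
    by (rule integrable_coordinate[OF i, where F = "\<lambda>y. exp (c * \<bar>y\<bar>)"], force intro!: continuous_intros)
       (rule integrable_coordinate[OF i, where F = "\<lambda>y. y"], force intro!: continuous_intros,
        rule integrable_coordinate[OF i, where F = "\<lambda>y. exp (c * y)"], force intro!: continuous_intros)
  have pointwise: "exp (l * y) \<le> 1 + l * y + 360\<^sup>2 * l\<^sup>2 * exp (1 / 180 * \<bar>y\<bar>)" for y :: real
  proof -
    obtain t where t: "\<bar>t\<bar> \<le> \<bar>l * y\<bar>" "exp (l * y) = (\<Sum>m<2. (l * y) ^ m / fact m) + exp t / fact 2 * (l * y) ^ 2"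
      using Maclaurin_exp_le[of "l * y" 2] by blast
    \<comment> \<open>The rate \<open>1/180\<close> is split in two: one half absorbs the remainder \<open>exp t\<close>, the other the factor \<open>y\<^sup>2\<close>.\<close>
    define w where "w = \<bar>y\<bar> / 360"
    have "\<bar>l * y\<bar> \<le> 1 / 360 * \<bar>y\<bar>" unfolding abs_mult by (intro mult_right_mono l) simp
    then have "exp t \<le> exp w" using t(1) by (simp add: w_def)
    moreover have "w\<^sup>2 / 2 \<le> exp w"
      using exp_lower_Taylor_quadratic[of w] by (simp add: w_def)
    ultimately have "exp t * (w\<^sup>2 / 2) \<le> exp w * exp w" by (intro mult_mono) auto
    also have "\<dots> = exp (1 / 180 * \<bar>y\<bar>)" by (simp add: exp_add[symmetric] w_def)
    finally have "360\<^sup>2 * l\<^sup>2 * (exp t * (w\<^sup>2 / 2)) \<le> 360\<^sup>2 * l\<^sup>2 * exp (1 / 180 * \<bar>y\<bar>)"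
      by (intro mult_left_mono) auto
    moreover have "360\<^sup>2 * l\<^sup>2 * (exp t * (w\<^sup>2 / 2)) = exp t / fact 2 * (l * y) ^ 2"
      by (simp add: w_def power_divide power_mult_distrib)
    moreover have "(\<Sum>m<2. (l * y) ^ m / fact m) = 1 + l * y" by (simp add: numeral_2_eq_2)
    ultimately show ?thesis using t(2) by linarith
  qed
  have M: "0 < mean_abs i" using mean_abs_bounds(1)[OF i] by simp
  have rate: "1 / 180 \<le> ln 2 / (8 * mean_abs i)"
  proof -
    have "1 / 180 = (2 / 3) / (8 * (15::real))" by simp
    also have "\<dots> \<le> ln 2 / (8 * mean_abs i)"
      using ln2_ge_two_thirds mean_abs_bounds(2)[OF i] M by (intro frac_le) auto
    finally show ?thesis .
  qed
  have "expectation (\<lambda>x. exp (1 / 180 * \<bar>x i\<bar>)) \<le> expectation (\<lambda>x. exp (ln 2 / (8 * mean_abs i) * \<bar>x i\<bar>))"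
    using int(1) rate by (intro integral_mono) (auto simp only: exp_le_cancel_iff intro!: mult_right_mono)
  also have "\<dots> \<le> 3" by (rule exp_moment[OF i M])
  finally have E3: "expectation (\<lambda>x. exp (1 / 180 * \<bar>x i\<bar>)) \<le> 3" .
  have "expectation (\<lambda>x. exp (l * x i)) \<le> expectation (\<lambda>x. 1 + l * x i + 360\<^sup>2 * l\<^sup>2 * exp (1 / 180 * \<bar>x i\<bar>))"
    using int(1)[of "1/180"] int(2,3) pointwise by (intro integral_mono) auto
  also have "\<dots> = 1 + 360\<^sup>2 * l\<^sup>2 * expectation (\<lambda>x. exp (1 / 180 * \<bar>x i\<bar>))"
    using int(1)[of "1/180"] int(2) expectation_coordinate[OF i] by (simp add: prob_space)
  also have "\<dots> \<le> 1 + 360\<^sup>2 * l\<^sup>2 * 3" using E3 by (intro add_left_mono mult_left_mono) auto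
  also have "\<dots> \<le> exp (388800 * l\<^sup>2)" using exp_ge_add_one_self[of "388800 * l\<^sup>2"] by simp
  finally show ?thesis .
qed

text \<open>
  The body contains the cube of half-side \<open>1/150\<close>, since it contains the point \<open>M\<close>.
\<close>
lemma body_norm_le:
  assumes r: "0 < r" and x: "\<And>i. i < n \<Longrightarrow> \<bar>x i\<bar> \<le> r"
  shows "body_norm n C x \<le> 150 * r"
proof -
  have "restrict (\<lambda>i. x i / (150 * r)) {..<n} \<in> C"
  proof (rule solid[OF mean_abs_in_body])
    fix i assume i: "i < n"
    have "\<bar>x i / (150 * r)\<bar> \<le> r / (150 * r)"
      using r x[OF i] by (simp add: abs_divide divide_right_mono)
    also have "\<dots> \<le> mean_abs i" using mean_abs_bounds(1)[OF i] r by simp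
    finally show "\<bar>x i / (150 * r)\<bar> \<le> \<bar>restrict mean_abs {..<n} i\<bar>" using i by simp
  qed
  then show ?thesis
    unfolding body_norm_def using r by (intro cInf_lower) (auto intro!: bdd_belowI[of _ 0])
qed

end

section \<open>The maximum of coordinate sums\<close>

text \<open>
  Write \<open>S\<^sub>i\<close> for the \<open>i\<close>-th coordinate of \<open>\<Sum>\<^sub>j t\<^sub>j x\<^sub>j\<close>. The sum \<open>Y\<close> of all \<open>exp (\<plusminus> l S\<^sub>i)\<close> dominates
  \<open>exp (l max\<^sub>i \<bar>S\<^sub>i\<bar>)\<close>, and independence factors its mean, which is at most the number \<open>A\<close> below. The mean
  of \<open>ln Y\<close> is then at most \<open>ln A\<close> by concavity; this is used through the tangent inequality
  \<open>ln Y \<le> ln A - 1 + Y / A\<close>.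
\<close>
lemma multi_norm_bernstein:
  assumes n: "n \<ge> 1"
    and K: "isotropic_unconditional_body n K"
    and C: "\<And>j. j < s \<Longrightarrow> isotropic_unconditional_body n (C j)"
    and l: "0 < l" "\<And>j. j < s \<Longrightarrow> l * \<bar>t j\<bar> \<le> 1 / 360"
  shows "multi_norm n s C K t \<le> 150 / l * (ln (2 * real n) + 388800 * l\<^sup>2 * (\<Sum>j<s. (t j)\<^sup>2))"
proof -
  interpret L: product_sigma_finite "\<lambda>_. lborel_n n"
    using lborel_product.sigma_finite[of "{..<n}"] by (simp add: lborel_n_def product_sigma_finite_def)
  let ?M = "\<Pi>\<^sub>M j\<in>{..<s}. lborel_n n"
  let ?B = "\<Pi>\<^sub>E j\<in>{..<s}. C j"
  define S where "S x i = (\<Sum>j<s. t j * x j i)" for x :: "nat \<Rightarrow> nat \<Rightarrow> real" and i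
  define Y where "Y x = (\<Sum>i<n. exp (l * S x i) + exp (- l * S x i))" for x
  define V where "V = exp (388800 * l\<^sup>2 * (\<Sum>j<s. (t j)\<^sup>2))"
  define A where "A = 2 * real n * V"
  have A: "A > 0" using n by (simp add: A_def V_def)
  have ln_A: "ln A = ln (2 * real n) + 388800 * l\<^sup>2 * (\<Sum>j<s. (t j)\<^sup>2)"
    using n by (simp add: A_def V_def ln_mult)
  have ind: "indicator ?B x = (\<Prod>j<s. indicator (C j) (x j) :: real)" if "x \<in> space ?M" for x
  proof (cases "x \<in> ?B")
    case True
    then have "\<forall>j<s. x j \<in> C j" by (auto simp: PiE_iff)
    then show ?thesis using True by simp
  next
    case False
    moreover have "x \<in> extensional {..<s}" using that by (simp add: space_PiM PiE_def)
    ultimately obtain j where "j < s" "x j \<notin> C j" by (auto simp: PiE_iff)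
    then show ?thesis using False by (auto intro!: bexI[of _ j])
  qed
  have exp_int: "integrable ?M (\<lambda>x. indicator ?B x * exp (c * S x i))" (is ?I)
    and exp_le: "(\<integral>x. indicator ?B x * exp (c * S x i) \<partial>?M) \<le> V" (is ?L)
    if c: "\<bar>c\<bar> = l" and i: "i < n" for c i
  proof -
    define f where "f j y = indicator (C j) y * exp (c * t j * y i)" for j and y :: "nat \<Rightarrow> real"
    have f_int: "integrable (lborel_n n) (f j)" and f_le: "integral\<^sup>L (lborel_n n) (f j) \<le> exp (388800 * (c * t j)\<^sup>2)"
      and f_ge: "0 \<le> integral\<^sup>L (lborel_n n) (f j)"
      if j: "j < s" for j
    proof -
      interpret isotropic_unconditional_body n "C j" using C[OF j] .
      have "integrable uniform (\<lambda>x. exp (c * t j * x i))"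
        by (rule integrable_coordinate[OF i]) (auto intro!: continuous_intros)
      then show "integrable (lborel_n n) (f j)" by (simp add: integrable_uniform f_def[abs_def])
      have "integral\<^sup>L (lborel_n n) (f j) = expectation (\<lambda>x. exp (c * t j * x i))"
        by (simp add: integral_uniform set_lebesgue_integral_def f_def[abs_def])
      also have "\<dots> \<le> exp (388800 * (c * t j)\<^sup>2)"
        using l(2)[OF j] c by (intro mgf_coordinate[OF i]) (simp add: abs_mult)
      finally show "integral\<^sup>L (lborel_n n) (f j) \<le> exp (388800 * (c * t j)\<^sup>2)" .
      show "0 \<le> integral\<^sup>L (lborel_n n) (f j)" by (simp add: f_def[abs_def])
    qed
    have eq: "indicator ?B x * exp (c * S x i) = (\<Prod>j<s. f j (x j))" if "x \<in> space ?M" for x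
      using ind[OF that] by (simp add: f_def S_def prod.distrib exp_sum sum_distrib_left mult.assoc)
    have "integrable ?M (\<lambda>x. \<Prod>j<s. f j (x j))"
      by (rule L.product_integrable_prod) (auto simp: f_int)
    then show ?I using eq by (subst Bochner_Integration.integrable_cong[OF refl eq]) auto
    have "(\<integral>x. indicator ?B x * exp (c * S x i) \<partial>?M) = (\<integral>x. (\<Prod>j<s. f j (x j)) \<partial>?M)"
      by (rule Bochner_Integration.integral_cong[OF refl eq])
    also have "\<dots> = (\<Prod>j<s. integral\<^sup>L (lborel_n n) (f j))"
      by (rule L.product_integral_prod) (auto simp: f_int)
    also have "\<dots> \<le> (\<Prod>j<s. exp (388800 * (c * t j)\<^sup>2))"
      using f_le f_ge by (intro prod_mono) auto
    also have "\<dots> = V"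
    proof -
      have "c\<^sup>2 = l\<^sup>2" using c by (metis power2_abs)
      then have "(\<Sum>j<s. 388800 * (c * t j)\<^sup>2) = 388800 * l\<^sup>2 * (\<Sum>j<s. (t j)\<^sup>2)"
        by (simp add: power_mult_distrib sum_distrib_left mult.assoc)
      then show ?thesis by (simp add: V_def flip: exp_sum)
    qed
    finally show ?L .
  qed
  have one_int: "integrable ?M (\<lambda>x. indicator ?B x :: real)"
    and one: "(\<integral>x. indicator ?B x \<partial>?M) = (1::real)"
  proof -
    have C_int: "integrable (lborel_n n) (indicator (C j) :: _ \<Rightarrow> real)"
      and C_one: "integral\<^sup>L (lborel_n n) (indicator (C j)) = (1::real)" if j: "j < s" for j
    proof -
      interpret isotropic_unconditional_body n "C j" using C[OF j] .
      show "integrable (lborel_n n) (indicator (C j) :: _ \<Rightarrow> real)"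
        by (intro integrable_real_indicator sets_C) (simp add: emeasure_C)
      show "integral\<^sup>L (lborel_n n) (indicator (C j)) = (1::real)"
        using volume sets.sets_into_space[OF sets_C] by (simp add: Int_absorb2)
    qed
    have "integrable ?M (\<lambda>x. \<Prod>j<s. indicator (C j) (x j) :: real)"
      by (rule L.product_integrable_prod) (auto simp: C_int)
    then show "integrable ?M (\<lambda>x. indicator ?B x :: real)"
      by (subst Bochner_Integration.integrable_cong[OF refl ind]) auto
    have "(\<integral>x. indicator ?B x \<partial>?M) = (\<integral>x. (\<Prod>j<s. indicator (C j) (x j) :: real) \<partial>?M)"
      by (rule Bochner_Integration.integral_cong[OF refl ind])
    also have "\<dots> = (\<Prod>j<s. integral\<^sup>L (lborel_n n) (indicator (C j)))"
      by (rule L.product_integral_prod) (auto simp: C_int)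
    finally show "(\<integral>x. indicator ?B x \<partial>?M) = (1::real)" using C_one by simp
  qed
  have Y_split: "indicator ?B x * Y x = (\<Sum>i<n. indicator ?B x * exp (l * S x i) + indicator ?B x * exp (- l * S x i))" for x
    by (simp add: Y_def sum_distrib_left distrib_left)
  have Y_int: "integrable ?M (\<lambda>x. indicator ?B x * Y x)"
    unfolding Y_split using l(1)
    by (intro Bochner_Integration.integrable_sum Bochner_Integration.integrable_add exp_int) auto
  have Y_le: "(\<integral>x. indicator ?B x * Y x \<partial>?M) \<le> A"
  proof -
    have "(\<integral>x. indicator ?B x * Y x \<partial>?M) =
        (\<Sum>i<n. (\<integral>x. indicator ?B x * exp (l * S x i) \<partial>?M) + (\<integral>x. indicator ?B x * exp (- l * S x i) \<partial>?M))"
    proof -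
      have I: "integrable ?M (\<lambda>x. indicator ?B x * exp (l * S x i))"
        "integrable ?M (\<lambda>x. indicator ?B x * exp (- l * S x i))" if "i \<in> {..<n}" for i
        using exp_int[of l i] exp_int[of "- l" i] l(1) that by simp_all
      show ?thesis
        unfolding Y_split
        by (subst Bochner_Integration.integral_sum[OF Bochner_Integration.integrable_add[OF I]])
           (simp_all only: Bochner_Integration.integral_add[OF I] cong: sum.cong)
    qed
    also have "\<dots> \<le> (\<Sum>i<n. V + V)"
      using l(1) by (intro sum_mono add_mono exp_le) auto
    finally show ?thesis by (simp add: A_def)
  qed
  have bound: "body_norm n K (\<lambda>i\<in>{..<n}. S x i) \<le> 150 / l * (ln A - 1 + Y x / A)" for x
  proof -
    interpret K: isotropic_unconditional_body n K by (rule K)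
    have Yi: "exp (l * \<bar>S x i\<bar>) \<le> Y x" if "i < n" for i
    proof -
      have "exp (l * \<bar>S x i\<bar>) \<le> exp (l * S x i) + exp (- l * S x i)"
        by (cases "S x i \<ge> 0") auto
      also have "\<dots> \<le> Y x"
        unfolding Y_def using that by (intro member_le_sum) (auto intro: add_nonneg_nonneg)
      finally show ?thesis .
    qed
    have "exp (l * S x 0) + exp (- l * S x 0) \<le> Y x"
      unfolding Y_def using n by (intro member_le_sum) (auto intro: add_nonneg_nonneg)
    moreover have "2 \<le> exp (l * S x 0) + exp (- l * S x 0)"
      using exp_ge_add_one_self[of "l * S x 0"] exp_ge_add_one_self[of "- (l * S x 0)"]
      unfolding mult_minus_left by linarith
    ultimately have Y2: "2 \<le> Y x" by linarith
    have "body_norm n K (\<lambda>i\<in>{..<n}. S x i) \<le> 150 * (ln (Y x) / l)"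
    proof (rule K.body_norm_le)
      show "0 < ln (Y x) / l" using Y2 l by simp
      fix i assume i: "i < n"
      have "l * \<bar>S x i\<bar> \<le> ln (Y x)" using Yi[OF i] Y2 by (simp add: ln_ge_iff)
      then show "\<bar>(\<lambda>i\<in>{..<n}. S x i) i\<bar> \<le> ln (Y x) / l" using i l by (simp add: field_simps)
    qed
    also have "ln (Y x) = ln A + ln (Y x / A)" using Y2 A by (simp add: ln_div)
    also have "150 * ((ln A + ln (Y x / A)) / l) \<le> 150 * ((ln A + (Y x / A - 1)) / l)"
      using Y2 A l by (intro mult_left_mono divide_right_mono add_left_mono ln_le_minus_one) auto
    also have "\<dots> = 150 / l * (ln A - 1 + Y x / A)" by (simp add: algebra_simps)
    finally show ?thesis .
  qed
  have "multi_norm n s C K t = (\<integral>x. indicator ?B x * body_norm n K (\<lambda>i\<in>{..<n}. S x i) \<partial>?M)"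
    by (simp add: multi_norm_def set_lebesgue_integral_def S_def)
  also have "\<dots> \<le> 150 / l * ln A"
  \<comment> \<open>If the integrand is not integrable, its integral is 0 by convention, which is below the bound.\<close>
  proof (cases "integrable ?M (\<lambda>x. indicator ?B x * body_norm n K (\<lambda>i\<in>{..<n}. S x i))")
    case True
    have "(\<integral>x. indicator ?B x * body_norm n K (\<lambda>i\<in>{..<n}. S x i) \<partial>?M)
      \<le> (\<integral>x. 150 / l * (ln A - 1) * indicator ?B x + 150 / l / A * (indicator ?B x * Y x) \<partial>?M)"
    proof (rule integral_mono[OF True])
      show "integrable ?M (\<lambda>x. 150 / l * (ln A - 1) * indicator ?B x + 150 / l / A * (indicator ?B x * Y x))"
        using one_int Y_int by (intro Bochner_Integration.integrable_add integrable_mult_right) auto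
      fix x
      have "indicator ?B x * body_norm n K (\<lambda>i\<in>{..<n}. S x i) \<le> indicator ?B x * (150 / l * (ln A - 1 + Y x / A))"
        by (intro mult_left_mono bound) simp
      also have "\<dots> = 150 / l * (ln A - 1) * indicator ?B x + 150 / l / A * (indicator ?B x * Y x)"
        using A l(1) by (simp add: field_simps)
      finally show "indicator ?B x * body_norm n K (\<lambda>i\<in>{..<n}. S x i)
          \<le> 150 / l * (ln A - 1) * indicator ?B x + 150 / l / A * (indicator ?B x * Y x)" .
    qed
    also have "\<dots> = 150 / l * (ln A - 1) + 150 / l / A * (\<integral>x. indicator ?B x * Y x \<partial>?M)"
      using one_int Y_int one by (subst Bochner_Integration.integral_add) auto
    also have "\<dots> \<le> 150 / l * (ln A - 1) + 150 / l / A * A"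
      using Y_le A l by (intro add_left_mono mult_left_mono) auto
    also have "\<dots> = 150 / l * ln A" using A l by (simp add: field_simps)
    finally show ?thesis .
  next
    case False
    have "1 \<le> A" using n l by (simp add: A_def V_def mult_ge1_I one_le_exp_iff sum_nonneg)
    then show ?thesis using l False by (simp add: not_integrable_integral_eq)
  qed
  finally show ?thesis by (simp only: ln_A)
qed

theorem theorem1p6:
  "\<exists>c::real. c > 0 \<and>
    (\<forall>(n::nat) (s::nat) (K :: (nat \<Rightarrow> real) set) (C :: nat \<Rightarrow> (nat \<Rightarrow> real) set) (t :: nat \<Rightarrow> real).
      n \<ge> 2 \<longrightarrow> s \<ge> 1 \<longrightarrow>
      convex_body n K \<longrightarrow> isotropic n K \<longrightarrow> unconditional n K \<longrightarrow>
      (\<forall>j<s. convex_body n (C j) \<and> isotropic n (C j) \<and> unconditional n (C j)) \<longrightarrow>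
      multi_norm n s C K t
        \<le> c * sqrt (ln (real n)) * max (L2_set t {..<s}) (sqrt (ln (real n)) * max_norm s t))"
proof (intro exI[of _ "270000::real"] conjI allI impI)
  fix n s :: nat and K :: "(nat \<Rightarrow> real) set" and C :: "nat \<Rightarrow> (nat \<Rightarrow> real) set" and t :: "nat \<Rightarrow> real"
  assume n: "n \<ge> 2" and s: "s \<ge> 1" and K: "convex_body n K" "isotropic n K" "unconditional n K"
    and C: "\<forall>j<s. convex_body n (C j) \<and> isotropic n (C j) \<and> unconditional n (C j)"
  have body: "isotropic_unconditional_body n B"
    if "convex_body n B" "isotropic n B" "unconditional n B" for B
    using that by unfold_locales (auto simp: isotropic_def)
  note bernstein = multi_norm_bernstein[of n K s C _ t, OF _ body[OF K] body]
  define T where "T = max (L2_set t {..<s}) (sqrt (ln (real n)) * max_norm s t)"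
  define w where "w = sqrt (ln (real n))"
  have ln_n: "ln (real n) > 0" using n by simp
  have w: "w > 0" "w\<^sup>2 = ln (real n)" using ln_n by (auto simp: w_def)
  have sum_le: "(\<Sum>j<s. (t j)\<^sup>2) \<le> T\<^sup>2"
  proof -
    have "(\<Sum>j<s. (t j)\<^sup>2) = (L2_set t {..<s})\<^sup>2" by (simp add: L2_set_def sum_nonneg)
    also have "\<dots> \<le> T\<^sup>2" by (intro power_mono) (auto simp: T_def L2_set_nonneg)
    finally show ?thesis .
  qed
  have t_le: "w * \<bar>t j\<bar> \<le> T" if "j < s" for j
  proof -
    have "\<bar>t j\<bar> \<le> max_norm s t" using that by (auto simp: max_norm_def intro!: Max_ge)
    then have "w * \<bar>t j\<bar> \<le> w * max_norm s t" using w by (intro mult_left_mono) auto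
    then show ?thesis by (simp add: T_def w_def)
  qed
  have T: "T \<ge> 0" unfolding T_def by (simp add: L2_set_nonneg le_max_iff_disj)
  have "multi_norm n s C K t \<le> 270000 * w * T"
  proof (cases "T = 0")
    case True
    then have t0: "t j = 0" if "j < s" for j using t_le[OF that] w
      by (metis abs_ge_zero abs_eq_0 antisym mult_le_0_iff not_less)
    \<comment> \<open>For \<open>t = 0\<close> every \<open>l\<close> is admissible, and the bound vanishes as \<open>l\<close> grows.\<close>
    have le: "multi_norm n s C K t \<le> 150 / l * ln (2 * real n)" if "l > 0" for l
      using bernstein[of l] n C that t0 by simp
    have "multi_norm n s C K t \<le> 0"
    proof (rule ccontr)
      assume "\<not> ?thesis"
      then have m: "0 < multi_norm n s C K t" by simp
      have "ln (2 * real n) > 0" using n by simp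
      then show False using le[of "300 * ln (2 * real n) / multi_norm n s C K t"] m by simp
    qed
    then show ?thesis using True by simp
  next
    case False
    then have T: "T > 0" using T by simp
    \<comment> \<open>The largest parameter that \<open>w \<bar>t\<^sub>j\<bar> \<le> T\<close> admits; it makes both terms of the bound multiples of \<open>ln n\<close>.\<close>
    define l where "l = w / (360 * T)"
    have l: "l > 0" using w T by (simp add: l_def)
    have "l * \<bar>t j\<bar> \<le> 1 / 360" if "j < s" for j
      using t_le[OF that] T by (simp add: l_def field_simps)
    then have "multi_norm n s C K t \<le> 150 / l * (ln (2 * real n) + 388800 * l\<^sup>2 * (\<Sum>j<s. (t j)\<^sup>2))"
      using bernstein[of l] n C l by simp
    also have "\<dots> \<le> 150 / l * (2 * ln (real n) + 388800 * l\<^sup>2 * T\<^sup>2)"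
    proof -
      have "ln (2 * real n) \<le> ln (real n * real n)" using n by simp
      also have "\<dots> = 2 * ln (real n)" using n by (simp add: ln_mult)
      finally show ?thesis using sum_le l by (intro mult_left_mono add_mono) auto
    qed
    also have "388800 * l\<^sup>2 * T\<^sup>2 = 3 * ln (real n)"
      using T by (simp add: l_def power_divide power_mult_distrib w(2))
    also have "150 / l * (2 * ln (real n) + 3 * ln (real n)) = 270000 * w * T"
      using w T by (simp add: l_def field_simps power2_eq_square flip: w(2))
    finally show ?thesis .
  qed
  then show "multi_norm n s C K t
      \<le> 270000 * sqrt (ln (real n)) * max (L2_set t {..<s}) (sqrt (ln (real n)) * max_norm s t)"
    by (simp only: T_def w_def)
qed simp

end
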